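(* Let ${}_{\mathcal L}\mathbf{SBA}_n$, ${}_{\mathcal R}\mathbf{SBA}_n$ and $\mathbf{SBA}_n$ denote respectively the free left-handed, free right-handed and free skew Boolean algebra on $n$ generators. For all $n\ge1$: (i) $|{}_{\mathcal L}\mathbf{SBA}_n|=2^{\binom n1}3^{\binom n2}4^{\binom n3}\cdots(n+1)^{\binom nn}$. (ii) $|\mathbf{SBA}_n|=2^{\binom n1}5^{\binom n2}10^{\binom n3}\cdots(n^2+1)^{\binom nn}$. Moreover, if $\alpha_L(n)$, $\alpha_R(n)$ and $\alpha(n)$ denote the number of atoms in ${}_{\mathcal L}\mathbf{SBA}_n$, ${}_{\mathcal R}\mathbf{SBA}_n$ and $\mathbf{SBA}_n$, respectively, then: (iii) $\alpha_L(n)=\alpha_R(n)=\binom n1 1+\binom n2 2+\dots+\binom n{n-1}(n-1)+\binom nn n$. (iv) $\alpha(n)=\binom n1 1+\binom n2 4+\dots+\binom n{n-1}(n-1)^2+\binom nn n^2$.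
   Context: A skew lattice is an algebra $(S;\wedge,\vee)$ with associative binary operations satisfying $x\wedge(x\vee y)=x=(y\vee x)\wedge x$ and $x\vee(x\wedge y)=x=(y\wedge x)\vee x$. A skew Boolean algebra is an algebra $(S;\wedge,\vee,\setminus,0)$ such that $(S;\wedge,\vee)$ is a skew lattice satisfying $x\wedge(y\vee z)=(x\wedge y)\vee(x\wedge z)$ and $(x\vee y)\wedge z=(x\wedge z)\vee(y\wedge z)$, $0$ satisfies $0\wedge x=0=x\wedge 0$ and $0\vee x=x=x\vee 0$, and $(x\wedge y\wedge x)\vee(x\setminus y)=x$, $(x\wedge y\wedge x)\wedge(x\setminus y)=0=(x\setminus y)\wedge(x\wedge y\wedge x)$. It is left-handed if $x\wedge y\wedge x=x\wedge y$ and $x\vee y\vee x=y\vee x$ hold, right-handed if $x\wedge y\wedge x=y\wedge x$ and $x\vee y\vee x=x\vee y$ hold. Each of these classes is a variety, and free algebras are taken in the respective variety. The natural partial order is $x\ge y$ iff $x\wedge y=y=y\wedge x$; an atom is a minimal nonzero element in this order. *)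

theory Defs
  imports Main
begin

section \<open>Skew Boolean algebras\<close>

record 'a sk_alg =
  elems :: "'a set"
  sk_meet :: "'a \<Rightarrow> 'a \<Rightarrow> 'a" (infixl "\<sqinter>\<index>" 70)
  sk_join :: "'a \<Rightarrow> 'a \<Rightarrow> 'a" (infixl "\<squnion>\<index>" 65)
  sk_diff :: "'a \<Rightarrow> 'a \<Rightarrow> 'a" (infixl "\<setminus>\<index>" 70)
  sk_zero :: "'a" ("\<zero>\<index>")

locale sk_algebra =
  fixes S :: "'a sk_alg" (structure)
  assumes meet_closed: "x \<in> elems S \<Longrightarrow> y \<in> elems S \<Longrightarrow> x \<sqinter> y \<in> elems S"
    and join_closed: "x \<in> elems S \<Longrightarrow> y \<in> elems S \<Longrightarrow> x \<squnion> y \<in> elems S"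
    and diff_closed: "x \<in> elems S \<Longrightarrow> y \<in> elems S \<Longrightarrow> x \<setminus> y \<in> elems S"
    and zero_closed: "\<zero> \<in> elems S"

text \<open>The laws below only concern the reduct to meet and join.\<close>

locale skew_lattice = sk_algebra +
  assumes meet_assoc:
      "\<lbrakk>x \<in> elems S; y \<in> elems S; z \<in> elems S\<rbrakk> \<Longrightarrow> (x \<sqinter> y) \<sqinter> z = x \<sqinter> (y \<sqinter> z)"
    and join_assoc:
      "\<lbrakk>x \<in> elems S; y \<in> elems S; z \<in> elems S\<rbrakk> \<Longrightarrow> (x \<squnion> y) \<squnion> z = x \<squnion> (y \<squnion> z)"
    and meet_absorb_left: "\<lbrakk>x \<in> elems S; y \<in> elems S\<rbrakk> \<Longrightarrow> x \<sqinter> (x \<squnion> y) = x"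
    and meet_absorb_right: "\<lbrakk>x \<in> elems S; y \<in> elems S\<rbrakk> \<Longrightarrow> (y \<squnion> x) \<sqinter> x = x"
    and join_absorb_left: "\<lbrakk>x \<in> elems S; y \<in> elems S\<rbrakk> \<Longrightarrow> x \<squnion> (x \<sqinter> y) = x"
    and join_absorb_right: "\<lbrakk>x \<in> elems S; y \<in> elems S\<rbrakk> \<Longrightarrow> (y \<sqinter> x) \<squnion> x = x"

locale skew_boolean_algebra = skew_lattice +
  assumes distrib_left:
      "\<lbrakk>x \<in> elems S; y \<in> elems S; z \<in> elems S\<rbrakk> \<Longrightarrow> x \<sqinter> (y \<squnion> z) = (x \<sqinter> y) \<squnion> (x \<sqinter> z)"
    and distrib_right:
      "\<lbrakk>x \<in> elems S; y \<in> elems S; z \<in> elems S\<rbrakk> \<Longrightarrow> (x \<squnion> y) \<sqinter> z = (x \<sqinter> z) \<squnion> (y \<sqinter> z)"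
    and zero_meet: "x \<in> elems S \<Longrightarrow> \<zero> \<sqinter> x = \<zero>"
    and meet_zero: "x \<in> elems S \<Longrightarrow> x \<sqinter> \<zero> = \<zero>"
    and zero_join: "x \<in> elems S \<Longrightarrow> \<zero> \<squnion> x = x"
    and join_zero: "x \<in> elems S \<Longrightarrow> x \<squnion> \<zero> = x"
    and diff_join: "\<lbrakk>x \<in> elems S; y \<in> elems S\<rbrakk> \<Longrightarrow> (x \<sqinter> y \<sqinter> x) \<squnion> (x \<setminus> y) = x"
    and diff_meet_right: "\<lbrakk>x \<in> elems S; y \<in> elems S\<rbrakk> \<Longrightarrow> (x \<sqinter> y \<sqinter> x) \<sqinter> (x \<setminus> y) = \<zero>"
    and diff_meet_left: "\<lbrakk>x \<in> elems S; y \<in> elems S\<rbrakk> \<Longrightarrow> (x \<setminus> y) \<sqinter> (x \<sqinter> y \<sqinter> x) = \<zero>"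

locale left_handed_sba = skew_boolean_algebra +
  assumes left_handed_meet: "\<lbrakk>x \<in> elems S; y \<in> elems S\<rbrakk> \<Longrightarrow> x \<sqinter> y \<sqinter> x = x \<sqinter> y"
    and left_handed_join: "\<lbrakk>x \<in> elems S; y \<in> elems S\<rbrakk> \<Longrightarrow> x \<squnion> y \<squnion> x = y \<squnion> x"

locale right_handed_sba = skew_boolean_algebra +
  assumes right_handed_meet: "\<lbrakk>x \<in> elems S; y \<in> elems S\<rbrakk> \<Longrightarrow> x \<sqinter> y \<sqinter> x = y \<sqinter> x"
    and right_handed_join: "\<lbrakk>x \<in> elems S; y \<in> elems S\<rbrakk> \<Longrightarrow> x \<squnion> y \<squnion> x = x \<squnion> y"

definition sk_ge :: "'a sk_alg \<Rightarrow> 'a \<Rightarrow> 'a \<Rightarrow> bool" where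
  "sk_ge S x y \<longleftrightarrow> x \<sqinter>\<^bsub>S\<^esub> y = y \<and> y = y \<sqinter>\<^bsub>S\<^esub> x"

definition sk_atoms :: "'a sk_alg \<Rightarrow> 'a set" where
  "sk_atoms S = {a \<in> elems S. a \<noteq> \<zero>\<^bsub>S\<^esub> \<and>
     (\<forall>b \<in> elems S. b \<noteq> \<zero>\<^bsub>S\<^esub> \<longrightarrow> sk_ge S a b \<longrightarrow> b = a)}"

section \<open>Free algebras\<close>

definition sk_hom :: "('a \<Rightarrow> 'b) \<Rightarrow> 'a sk_alg \<Rightarrow> 'b sk_alg \<Rightarrow> bool" where
  "sk_hom h A B \<longleftrightarrow> (\<forall>x \<in> elems A. h x \<in> elems B) \<and> h \<zero>\<^bsub>A\<^esub> = \<zero>\<^bsub>B\<^esub> \<and>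
     (\<forall>x \<in> elems A. \<forall>y \<in> elems A.
        h (x \<sqinter>\<^bsub>A\<^esub> y) = h x \<sqinter>\<^bsub>B\<^esub> h y \<and>
        h (x \<squnion>\<^bsub>A\<^esub> y) = h x \<squnion>\<^bsub>B\<^esub> h y \<and>
        h (x \<setminus>\<^bsub>A\<^esub> y) = h x \<setminus>\<^bsub>B\<^esub> h y)"

definition sk_congruence :: "'a sk_alg \<Rightarrow> ('a \<times> 'a) set \<Rightarrow> bool" where
  "sk_congruence A \<theta> \<longleftrightarrow> equiv (elems A) \<theta> \<and>
     (\<forall>a b c d. (a, b) \<in> \<theta> \<longrightarrow> (c, d) \<in> \<theta> \<longrightarrow>
        (a \<sqinter>\<^bsub>A\<^esub> c, b \<sqinter>\<^bsub>A\<^esub> d) \<in> \<theta> \<and>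
        (a \<squnion>\<^bsub>A\<^esub> c, b \<squnion>\<^bsub>A\<^esub> d) \<in> \<theta> \<and>
        (a \<setminus>\<^bsub>A\<^esub> c, b \<setminus>\<^bsub>A\<^esub> d) \<in> \<theta>)"

definition sk_quotient :: "'a sk_alg \<Rightarrow> ('a \<times> 'a) set \<Rightarrow> 'a set sk_alg" where
  "sk_quotient A \<theta> = \<lparr>
     elems = elems A // \<theta>,
     sk_meet = (\<lambda>P Q. \<theta> `` {a \<sqinter>\<^bsub>A\<^esub> b | a b. a \<in> P \<and> b \<in> Q}),
     sk_join = (\<lambda>P Q. \<theta> `` {a \<squnion>\<^bsub>A\<^esub> b | a b. a \<in> P \<and> b \<in> Q}),
     sk_diff = (\<lambda>P Q. \<theta> `` {a \<setminus>\<^bsub>A\<^esub> b | a b. a \<in> P \<and> b \<in> Q}),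
     sk_zero = \<theta> `` {\<zero>\<^bsub>A\<^esub>}\<rparr>"

datatype 'v sk_term =
    Gen 'v
  | Zero
  | Meet "'v sk_term" "'v sk_term"
  | Join "'v sk_term" "'v sk_term"
  | Diff "'v sk_term" "'v sk_term"

definition term_alg :: "'v set \<Rightarrow> 'v sk_term sk_alg" where
  "term_alg X = \<lparr>elems = {t. set_sk_term t \<subseteq> X},
     sk_meet = Meet, sk_join = Join, sk_diff = Diff, sk_zero = Zero\<rparr>"

text \<open>The free algebra over \<open>X\<close> in a variety \<open>V\<close> is the quotient of the term algebra over
  \<open>X\<close> by its least congruence with quotient in \<open>V\<close>. The lemmas at the end of this theory
  show, for the three varieties used, that it belongs to \<open>V\<close> and has the universal property
  with respect to algebras of \<open>V\<close> over an arbitrary type.\<close>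

definition free_cong ::
    "('v sk_term set sk_alg \<Rightarrow> bool) \<Rightarrow> 'v set \<Rightarrow> ('v sk_term \<times> 'v sk_term) set" where
  "free_cong V X = \<Inter> {\<theta>. sk_congruence (term_alg X) \<theta> \<and> V (sk_quotient (term_alg X) \<theta>)}"

definition free_alg ::
    "('v sk_term set sk_alg \<Rightarrow> bool) \<Rightarrow> 'v set \<Rightarrow> 'v sk_term set sk_alg" where
  "free_alg V X = sk_quotient (term_alg X) (free_cong V X)"

definition free_gen :: "('v sk_term set sk_alg \<Rightarrow> bool) \<Rightarrow> 'v set \<Rightarrow> 'v \<Rightarrow> 'v sk_term set" where
  "free_gen V X x = free_cong V X `` {Gen x}"

definition LSBA :: "nat \<Rightarrow> nat sk_term set sk_alg" where
  "LSBA n = free_alg left_handed_sba {..<n}"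

definition RSBA :: "nat \<Rightarrow> nat sk_term set sk_alg" where
  "RSBA n = free_alg right_handed_sba {..<n}"

definition SBA :: "nat \<Rightarrow> nat sk_term set sk_alg" where
  "SBA n = free_alg skew_boolean_algebra {..<n}"

section \<open>Adequacy of the construction of free algebras\<close>

lemma sk_homD:
  assumes "sk_hom h A B"
  shows "x \<in> elems A \<Longrightarrow> h x \<in> elems B"
    and "h \<zero>\<^bsub>A\<^esub> = \<zero>\<^bsub>B\<^esub>"
    and "x \<in> elems A \<Longrightarrow> y \<in> elems A \<Longrightarrow> h (x \<sqinter>\<^bsub>A\<^esub> y) = h x \<sqinter>\<^bsub>B\<^esub> h y"
    and "x \<in> elems A \<Longrightarrow> y \<in> elems A \<Longrightarrow> h (x \<squnion>\<^bsub>A\<^esub> y) = h x \<squnion>\<^bsub>B\<^esub> h y"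
    and "x \<in> elems A \<Longrightarrow> y \<in> elems A \<Longrightarrow> h (x \<setminus>\<^bsub>A\<^esub> y) = h x \<setminus>\<^bsub>B\<^esub> h y"
  using assms by (auto simp: sk_hom_def)

definition sk_separated :: "('b sk_alg \<Rightarrow> bool) \<Rightarrow> 'a sk_alg \<Rightarrow> bool" where
  "sk_separated V A \<longleftrightarrow> (\<forall>a \<in> elems A. \<forall>b \<in> elems A.
     (\<forall>h B. V B \<longrightarrow> sk_hom h A B \<longrightarrow> h a = h b) \<longrightarrow> a = b)"

lemma sk_separatedI:
  assumes "\<And>a b. \<lbrakk>a \<in> elems A; b \<in> elems A; \<And>h B. V B \<Longrightarrow> sk_hom h A B \<Longrightarrow> h a = h b\<rbrakk> \<Longrightarrow> a = b"
  shows "sk_separated V A"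
  unfolding sk_separated_def using assms by blast

lemma sk_separatedD:
  assumes "sk_separated V A" "a \<in> elems A" "b \<in> elems A"
    "\<And>h B. V B \<Longrightarrow> sk_hom h A B \<Longrightarrow> h a = h b"
  shows "a = b"
  using assms unfolding sk_separated_def by blast

lemma sk_separated_mono:
  assumes "sk_separated V A" "\<And>B. V B \<Longrightarrow> W B"
  shows "sk_separated W A"
  using assms unfolding sk_separated_def by blast

text \<open>Each class contains every algebra whose points are separated by homomorphisms into it.\<close>

lemma sba_separated:
  fixes A :: "'a sk_alg"
  assumes A: "sk_algebra A" and sep: "sk_separated (skew_boolean_algebra :: 'b sk_alg \<Rightarrow> bool) A"
  shows "skew_boolean_algebra A"
proof -
  interpret A: sk_algebra A by (rule A)
  note cl = A.meet_closed A.join_closed A.diff_closed A.zero_closed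
  show ?thesis
    by (unfold_locales;
        (rule sk_separatedD[OF sep], simp add: cl, simp add: cl, simp add: sk_hom_def cl,
         (rule skew_lattice.meet_assoc skew_lattice.join_assoc
            skew_lattice.meet_absorb_left skew_lattice.meet_absorb_right
            skew_lattice.join_absorb_left skew_lattice.join_absorb_right
            skew_boolean_algebra.distrib_left skew_boolean_algebra.distrib_right
            skew_boolean_algebra.zero_meet skew_boolean_algebra.meet_zero
            skew_boolean_algebra.zero_join skew_boolean_algebra.join_zero
            skew_boolean_algebra.diff_join
            skew_boolean_algebra.diff_meet_left skew_boolean_algebra.diff_meet_right;
          simp add: skew_boolean_algebra.axioms(1))))
qed

lemma left_handed_separated:
  fixes A :: "'a sk_alg"
  assumes A: "sk_algebra A" and sep: "sk_separated (left_handed_sba :: 'b sk_alg \<Rightarrow> bool) A"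
  shows "left_handed_sba A"
proof -
  interpret A: sk_algebra A by (rule A)
  note cl = A.meet_closed A.join_closed A.diff_closed A.zero_closed
  interpret A: skew_boolean_algebra A
    by (rule sba_separated[OF A sk_separated_mono[OF sep]]) (rule left_handed_sba.axioms(1))
  show ?thesis
    by (unfold_locales; rule sk_separatedD[OF sep])
       (simp_all add: cl sk_hom_def left_handed_sba.left_handed_meet
         left_handed_sba.left_handed_join)
qed

lemma right_handed_separated:
  fixes A :: "'a sk_alg"
  assumes A: "sk_algebra A" and sep: "sk_separated (right_handed_sba :: 'b sk_alg \<Rightarrow> bool) A"
  shows "right_handed_sba A"
proof -
  interpret A: sk_algebra A by (rule A)
  note cl = A.meet_closed A.join_closed A.diff_closed A.zero_closed
  interpret A: skew_boolean_algebra A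
    by (rule sba_separated[OF A sk_separated_mono[OF sep]]) (rule right_handed_sba.axioms(1))
  show ?thesis
    by (unfold_locales; rule sk_separatedD[OF sep])
       (simp_all add: cl sk_hom_def right_handed_sba.right_handed_meet
         right_handed_sba.right_handed_join)
qed

lemma sk_algebra_term_alg: "sk_algebra (term_alg X)"
  by unfold_locales (auto simp: term_alg_def)

lemma quotient_ops:
  assumes "sk_congruence A \<theta>" "a \<in> elems A" "b \<in> elems A"
  shows "sk_meet (sk_quotient A \<theta>) (\<theta> `` {a}) (\<theta> `` {b}) = \<theta> `` {a \<sqinter>\<^bsub>A\<^esub> b}"
    and "sk_join (sk_quotient A \<theta>) (\<theta> `` {a}) (\<theta> `` {b}) = \<theta> `` {a \<squnion>\<^bsub>A\<^esub> b}"
    and "sk_diff (sk_quotient A \<theta>) (\<theta> `` {a}) (\<theta> `` {b}) = \<theta> `` {a \<setminus>\<^bsub>A\<^esub> b}"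
proof -
  have eq: "equiv (elems A) \<theta>" using assms(1) by (simp add: sk_congruence_def)
  have rf: "(a, a) \<in> \<theta>" "(b, b) \<in> \<theta>"
    using eq assms(2,3) by (auto simp: equiv_def refl_on_def)
  have tr: "\<And>x y z. (x, y) \<in> \<theta> \<Longrightarrow> (y, z) \<in> \<theta> \<Longrightarrow> (x, z) \<in> \<theta>"
    using eq by (auto simp: equiv_def elim: transE)
  have "\<theta> `` {f x y | x y. x \<in> \<theta> `` {a} \<and> y \<in> \<theta> `` {b}} = \<theta> `` {f a b}"
    if "\<And>x y. (a, x) \<in> \<theta> \<Longrightarrow> (b, y) \<in> \<theta> \<Longrightarrow> (f a b, f x y) \<in> \<theta>" for f
    using that rf tr by fast
  with assms(1) show "sk_meet (sk_quotient A \<theta>) (\<theta> `` {a}) (\<theta> `` {b}) = \<theta> `` {a \<sqinter>\<^bsub>A\<^esub> b}"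
    and "sk_join (sk_quotient A \<theta>) (\<theta> `` {a}) (\<theta> `` {b}) = \<theta> `` {a \<squnion>\<^bsub>A\<^esub> b}"
    and "sk_diff (sk_quotient A \<theta>) (\<theta> `` {a}) (\<theta> `` {b}) = \<theta> `` {a \<setminus>\<^bsub>A\<^esub> b}"
    unfolding sk_congruence_def by (simp_all add: sk_quotient_def)
qed

lemma elems_quotient: "elems (sk_quotient A \<theta>) = elems A // \<theta>"
  and zero_quotient: "\<zero>\<^bsub>sk_quotient A \<theta>\<^esub> = \<theta> `` {\<zero>\<^bsub>A\<^esub>}"
  by (simp_all add: sk_quotient_def)

lemma sk_algebra_quotient:
  assumes A: "sk_algebra A" and c: "sk_congruence A \<theta>"
  shows "sk_algebra (sk_quotient A \<theta>)"
proof -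
  interpret A: sk_algebra A by (rule A)
  show ?thesis
    by unfold_locales
       (auto simp: elems_quotient zero_quotient quotient_ops[OF c] elim!: quotientE
         intro!: quotientI A.meet_closed A.join_closed A.diff_closed A.zero_closed)
qed

text \<open>A homomorphism whose kernel contains the congruence factors through the quotient.\<close>

lemma quotient_lift:
  assumes A: "sk_algebra A" and c: "sk_congruence A \<theta>" and h: "sk_hom h A B"
    and ker: "\<And>a b. (a, b) \<in> \<theta> \<Longrightarrow> h a = h b"
  shows "\<exists>g. sk_hom g (sk_quotient A \<theta>) B \<and> (\<forall>a \<in> elems A. g (\<theta> `` {a}) = h a)"
proof -
  interpret A: sk_algebra A by (rule A)
  have eq: "equiv (elems A) \<theta>" using c by (simp add: sk_congruence_def)
  define g where "g P = h (SOME a. a \<in> P)" for P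
  have g: "g (\<theta> `` {a}) = h a" if "a \<in> elems A" for a
  proof -
    have "a \<in> \<theta> `` {a}" using equiv_class_self[OF eq that] .
    hence "(SOME b. b \<in> \<theta> `` {a}) \<in> \<theta> `` {a}" by (rule someI)
    thus ?thesis using ker by (simp add: g_def)
  qed
  have "sk_hom g (sk_quotient A \<theta>) B"
    unfolding sk_hom_def elems_quotient zero_quotient
    by (auto elim!: quotientE simp: quotient_ops[OF c] g sk_homD[OF h]
        A.meet_closed A.join_closed A.diff_closed A.zero_closed)
  with g show ?thesis by (intro exI[of _ g]) simp
qed

lemma quotient_hom:
  assumes "sk_algebra A" "sk_congruence A \<theta>"
  shows "sk_hom (\<lambda>a. \<theta> `` {a}) A (sk_quotient A \<theta>)"
  using assms(2) by (auto simp: sk_hom_def elems_quotient zero_quotient quotient_ops quotientI)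

lemma kernel_congruence:
  assumes A: "sk_algebra A" and h: "sk_hom h A B"
  defines "\<theta> \<equiv> {(a, b). a \<in> elems A \<and> b \<in> elems A \<and> h a = h b}"
  shows "sk_congruence A \<theta>"
proof -
  interpret A: sk_algebra A by (rule A)
  have "equiv (elems A) \<theta>"
    by (intro equivI refl_onI symI transI) (auto simp: \<theta>_def)
  thus ?thesis
    by (auto simp: sk_congruence_def \<theta>_def sk_homD[OF h]
        A.meet_closed A.join_closed A.diff_closed)
qed

lemma Inter_congruence:
  assumes "\<And>\<theta>. \<theta> \<in> T \<Longrightarrow> sk_congruence A \<theta>" "T \<noteq> {}"
  shows "sk_congruence A (\<Inter> T)"
proof -
  have e: "equiv (elems A) \<theta>" if "\<theta> \<in> T" for \<theta>
    using assms(1)[OF that] by (simp add: sk_congruence_def)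
  have "equiv (elems A) (\<Inter> T)"
  proof (intro equivI refl_onI symI transI)
    show "\<Inter> T \<subseteq> elems A \<times> elems A"
      using assms(2) e equiv_type by blast
    show "(x, x) \<in> \<Inter> T" if "x \<in> elems A" for x
      using e that by (auto simp: equiv_def refl_on_def)
    show "(y, x) \<in> \<Inter> T" if "(x, y) \<in> \<Inter> T" for x y
      using e that by (auto simp: equiv_def dest: symD)
    show "(x, z) \<in> \<Inter> T" if "(x, y) \<in> \<Inter> T" "(y, z) \<in> \<Inter> T" for x y z
      using e that unfolding equiv_def by (blast dest: transD)
  qed
  thus ?thesis using assms(1) unfolding sk_congruence_def by blast
qed

lemma total_congruence:
  assumes "sk_algebra A"
  shows "sk_congruence A (elems A \<times> elems A)"
  using assms by (auto simp: sk_congruence_def sk_algebra_def equiv_def refl_on_def sym_def trans_def)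

lemma total_quotient_trivial:
  assumes "P \<in> elems (sk_quotient A (elems A \<times> elems A))"
    "Q \<in> elems (sk_quotient A (elems A \<times> elems A))"
  shows "P = Q"
  using assms by (auto simp: elems_quotient elim!: quotientE)

text \<open>The hypothesis on \<open>V\<close> is the closure property established for the three classes above.\<close>

lemma free_alg_general:
  fixes V :: "'v sk_term set sk_alg \<Rightarrow> bool"
  assumes sep: "\<And>A. sk_algebra A \<Longrightarrow> sk_separated V A \<Longrightarrow> V A"
  shows free_cong_congruence: "sk_congruence (term_alg X) (free_cong V X)"
    and free_alg_in_class: "V (free_alg V X)"
proof -
  let ?A = "term_alg X"
  let ?T = "{\<theta>. sk_congruence ?A \<theta> \<and> V (sk_quotient ?A \<theta>)}"
  note A = sk_algebra_term_alg[of X]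
  have "V (sk_quotient ?A (elems ?A \<times> elems ?A))"
    by (rule sep[OF sk_algebra_quotient[OF A total_congruence[OF A]] sk_separatedI])
       (rule total_quotient_trivial)
  hence ne: "?T \<noteq> {}" using total_congruence[OF A] by blast
  show c: "sk_congruence ?A (free_cong V X)"
    unfolding free_cong_def by (rule Inter_congruence[OF _ ne]) simp
  show "V (free_alg V X)"
    unfolding free_alg_def
  proof (rule sep[OF sk_algebra_quotient[OF A c] sk_separatedI])
    fix P Q
    assume P: "P \<in> elems (sk_quotient ?A (free_cong V X))"
      and Q: "Q \<in> elems (sk_quotient ?A (free_cong V X))"
      and all: "\<And>h (B :: 'v sk_term set sk_alg). V B \<Longrightarrow>
        sk_hom h (sk_quotient ?A (free_cong V X)) B \<Longrightarrow> h P = h Q"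
    obtain a where a: "a \<in> elems ?A" "P = free_cong V X `` {a}"
      using P by (auto simp: elems_quotient elim: quotientE)
    obtain b where b: "b \<in> elems ?A" "Q = free_cong V X `` {b}"
      using Q by (auto simp: elems_quotient elim: quotientE)
    have "(a, b) \<in> \<theta>" if t: "\<theta> \<in> ?T" for \<theta>
    proof -
      from t have t1: "sk_congruence ?A \<theta>" and t2: "V (sk_quotient ?A \<theta>)" by auto
      have eq: "equiv (elems ?A) \<theta>" using t1 by (simp add: sk_congruence_def)
      have ker: "\<theta> `` {x} = \<theta> `` {y}" if "(x, y) \<in> free_cong V X" for x y
        using that t by (intro equiv_class_eq[OF eq]) (auto simp: free_cong_def)
      obtain g where g: "sk_hom g (sk_quotient ?A (free_cong V X)) (sk_quotient ?A \<theta>)"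
        "\<forall>x \<in> elems ?A. g (free_cong V X `` {x}) = \<theta> `` {x}"
        using quotient_lift[OF A c quotient_hom[OF A t1] ker] by auto
      have "\<theta> `` {a} = \<theta> `` {b}" using all[OF t2 g(1)] g(2) a b by simp
      thus ?thesis using eq_equiv_class[OF _ eq b(1)] by blast
    qed
    hence "(a, b) \<in> free_cong V X" by (auto simp: free_cong_def)
    moreover have "equiv (elems ?A) (free_cong V X)" using c by (simp add: sk_congruence_def)
    ultimately show "P = Q" using a b equiv_class_eq by fast
  qed
qed

primrec sk_eval :: "'b sk_alg \<Rightarrow> ('v \<Rightarrow> 'b) \<Rightarrow> 'v sk_term \<Rightarrow> 'b" where
  "sk_eval B f (Gen x) = f x"
| "sk_eval B f Zero = \<zero>\<^bsub>B\<^esub>"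
| "sk_eval B f (Meet s t) = sk_eval B f s \<sqinter>\<^bsub>B\<^esub> sk_eval B f t"
| "sk_eval B f (Join s t) = sk_eval B f s \<squnion>\<^bsub>B\<^esub> sk_eval B f t"
| "sk_eval B f (Diff s t) = sk_eval B f s \<setminus>\<^bsub>B\<^esub> sk_eval B f t"

lemma sk_eval_hom:
  assumes B: "sk_algebra B" and f: "\<And>x. x \<in> X \<Longrightarrow> f x \<in> elems B"
  shows "sk_hom (sk_eval B f) (term_alg X) B"
proof -
  interpret B: sk_algebra B by (rule B)
  have "sk_eval B f t \<in> elems B" if "set_sk_term t \<subseteq> X" for t
    using that
    by (induction t) (auto intro: f B.meet_closed B.join_closed B.diff_closed B.zero_closed)
  thus ?thesis by (auto simp: sk_hom_def term_alg_def)
qed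

lemma free_alg_universal_general:
  fixes V :: "'v sk_term set sk_alg \<Rightarrow> bool" and B :: "'b sk_alg"
  assumes sep: "\<And>A. sk_algebra A \<Longrightarrow> sk_separated V A \<Longrightarrow> V A"
    and sepB: "\<And>A. sk_algebra A \<Longrightarrow> sk_separated ((=) B) A \<Longrightarrow> V A"
    and B: "sk_algebra B" and f: "\<And>x. x \<in> X \<Longrightarrow> f x \<in> elems B"
  shows "\<exists>h. sk_hom h (free_alg V X) B \<and> (\<forall>x \<in> X. h (free_gen V X x) = f x) \<and>
    (\<forall>h'. sk_hom h' (free_alg V X) B \<and> (\<forall>x \<in> X. h' (free_gen V X x) = f x) \<longrightarrow>
      (\<forall>a \<in> elems (free_alg V X). h' a = h a))"
proof -
  let ?A = "term_alg X"
  let ?e = "sk_eval B f"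
  define \<theta> where "\<theta> = {(a, b). a \<in> elems ?A \<and> b \<in> elems ?A \<and> ?e a = ?e b}"
  note A = sk_algebra_term_alg[of X]
  have e: "sk_hom ?e ?A B" by (rule sk_eval_hom[OF B f])
  have t: "sk_congruence ?A \<theta>" unfolding \<theta>_def by (rule kernel_congruence[OF A e])
  have ker: "?e a = ?e b" if "(a, b) \<in> \<theta>" for a b
    using that by (simp add: \<theta>_def)
  obtain g where g: "sk_hom g (sk_quotient ?A \<theta>) B"
    "\<forall>a \<in> elems ?A. g (\<theta> `` {a}) = ?e a"
    using quotient_lift[OF A t e ker] by auto
  have "V (sk_quotient ?A \<theta>)"
  proof (rule sepB[OF sk_algebra_quotient[OF A t] sk_separatedI])
    fix P Q
    assume "P \<in> elems (sk_quotient ?A \<theta>)" "Q \<in> elems (sk_quotient ?A \<theta>)"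
      and all: "\<And>h C. B = C \<Longrightarrow> sk_hom h (sk_quotient ?A \<theta>) C \<Longrightarrow> h P = h Q"
    then obtain a b where ab: "a \<in> elems ?A" "P = \<theta> `` {a}" "b \<in> elems ?A" "Q = \<theta> `` {b}"
      by (auto simp: elems_quotient elim!: quotientE)
    have "?e a = ?e b" using all[OF refl g(1)] g(2) ab by simp
    thus "P = Q" using ab by (auto simp: \<theta>_def)
  qed
  hence le: "free_cong V X \<subseteq> \<theta>" using t by (auto simp: free_cong_def)
  have c: "sk_congruence ?A (free_cong V X)" by (rule free_cong_congruence[OF sep])
  have ker': "?e a = ?e b" if "(a, b) \<in> free_cong V X" for a b
    using that le ker by blast
  obtain h where h: "sk_hom h (free_alg V X) B"
    "\<forall>a \<in> elems ?A. h (free_cong V X `` {a}) = ?e a"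
    using quotient_lift[OF A c e ker'] by (auto simp: free_alg_def)
  have uniq: "h' a = h a"
    if h': "sk_hom h' (free_alg V X) B" "\<forall>x \<in> X. h' (free_gen V X x) = f x"
      and a: "a \<in> elems (free_alg V X)" for h' a
  proof -
    have "h' (free_cong V X `` {s}) = ?e s" if "s \<in> elems ?A" for s
      using that
    proof (induction s)
      case (Gen x)
      thus ?case using h'(2) by (auto simp: free_gen_def term_alg_def)
    next
      case Zero
      thus ?case using sk_homD(2)[OF h'(1)]
        by (simp add: free_alg_def zero_quotient) (simp add: term_alg_def)
    next
      case (Meet s t)
      hence el: "s \<in> elems ?A" "t \<in> elems ?A" by (auto simp: term_alg_def)
      have "free_cong V X `` {r} \<in> elems (free_alg V X)" if "r \<in> elems ?A" for r
        using that by (simp add: free_alg_def elems_quotient quotientI)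
      from sk_homD(3)[OF h'(1) this[OF el(1)] this[OF el(2)]] show ?case
        using Meet.IH el quotient_ops(1)[OF c el]
        by (simp add: free_alg_def) (simp add: term_alg_def)
    next
      case (Join s t)
      hence el: "s \<in> elems ?A" "t \<in> elems ?A" by (auto simp: term_alg_def)
      have "free_cong V X `` {r} \<in> elems (free_alg V X)" if "r \<in> elems ?A" for r
        using that by (simp add: free_alg_def elems_quotient quotientI)
      from sk_homD(4)[OF h'(1) this[OF el(1)] this[OF el(2)]] show ?case
        using Join.IH el quotient_ops(2)[OF c el]
        by (simp add: free_alg_def) (simp add: term_alg_def)
    next
      case (Diff s t)
      hence el: "s \<in> elems ?A" "t \<in> elems ?A" by (auto simp: term_alg_def)
      have "free_cong V X `` {r} \<in> elems (free_alg V X)" if "r \<in> elems ?A" for r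
        using that by (simp add: free_alg_def elems_quotient quotientI)
      from sk_homD(5)[OF h'(1) this[OF el(1)] this[OF el(2)]] show ?case
        using Diff.IH el quotient_ops(3)[OF c el]
        by (simp add: free_alg_def) (simp add: term_alg_def)
    qed
    moreover obtain s where "s \<in> elems ?A" "a = free_cong V X `` {s}"
      using a by (auto simp: free_alg_def elems_quotient elim: quotientE)
    ultimately show ?thesis using h(2) by simp
  qed
  have gen: "\<forall>x \<in> X. h (free_gen V X x) = f x"
  proof
    fix x assume "x \<in> X"
    thus "h (free_gen V X x) = f x"
      using bspec[OF h(2), of "Gen x"] by (simp add: free_gen_def term_alg_def)
  qed
  show ?thesis
  proof (intro exI[of _ h] conjI h(1) gen allI impI ballI)
    fix h' a
    assume *: "sk_hom h' (free_alg V X) B \<and> (\<forall>x \<in> X. h' (free_gen V X x) = f x)"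
      and a: "a \<in> elems (free_alg V X)"
    show "h' a = h a" by (rule uniq[OF conjunct1[OF *] conjunct2[OF *] a])
  qed
qed

theorem free_sba:
  "skew_boolean_algebra (free_alg skew_boolean_algebra X)"
  by (rule free_alg_in_class) (rule sba_separated)

theorem free_left_handed_sba:
  "left_handed_sba (free_alg left_handed_sba X)"
  by (rule free_alg_in_class) (rule left_handed_separated)

theorem free_right_handed_sba:
  "right_handed_sba (free_alg right_handed_sba X)"
  by (rule free_alg_in_class) (rule right_handed_separated)

theorem free_sba_universal:
  fixes B :: "'b sk_alg" and X :: "'v set"
  defines "F \<equiv> free_alg skew_boolean_algebra X"
    and "gen \<equiv> free_gen skew_boolean_algebra X"
  assumes B: "skew_boolean_algebra B" and f: "\<And>x. x \<in> X \<Longrightarrow> f x \<in> elems B"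
  shows "\<exists>h. sk_hom h F B \<and> (\<forall>x \<in> X. h (gen x) = f x) \<and>
    (\<forall>h'. sk_hom h' F B \<and> (\<forall>x \<in> X. h' (gen x) = f x) \<longrightarrow> (\<forall>a \<in> elems F. h' a = h a))"
  unfolding F_def gen_def
proof (rule free_alg_universal_general)
  show "sk_algebra B"
    using B by (simp add: skew_boolean_algebra_def skew_lattice_def)
  show "skew_boolean_algebra A" if "sk_algebra A" "sk_separated ((=) B) A" for A :: "'v sk_term set sk_alg"
    by (rule sba_separated[OF that(1) sk_separated_mono[OF that(2)]]) (use B in simp)
qed (rule sba_separated f; assumption)+

theorem free_left_handed_sba_universal:
  fixes B :: "'b sk_alg" and X :: "'v set"
  defines "F \<equiv> free_alg left_handed_sba X"
    and "gen \<equiv> free_gen left_handed_sba X"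
  assumes B: "left_handed_sba B" and f: "\<And>x. x \<in> X \<Longrightarrow> f x \<in> elems B"
  shows "\<exists>h. sk_hom h F B \<and> (\<forall>x \<in> X. h (gen x) = f x) \<and>
    (\<forall>h'. sk_hom h' F B \<and> (\<forall>x \<in> X. h' (gen x) = f x) \<longrightarrow> (\<forall>a \<in> elems F. h' a = h a))"
  unfolding F_def gen_def
proof (rule free_alg_universal_general)
  show "sk_algebra B"
    using B by (simp add: left_handed_sba_def skew_boolean_algebra_def skew_lattice_def)
  show "left_handed_sba A" if "sk_algebra A" "sk_separated ((=) B) A" for A :: "'v sk_term set sk_alg"
    by (rule left_handed_separated[OF that(1) sk_separated_mono[OF that(2)]]) (use B in simp)
qed (rule left_handed_separated f; assumption)+

theorem free_right_handed_sba_universal: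
  fixes B :: "'b sk_alg" and X :: "'v set"
  defines "F \<equiv> free_alg right_handed_sba X"
    and "gen \<equiv> free_gen right_handed_sba X"
  assumes B: "right_handed_sba B" and f: "\<And>x. x \<in> X \<Longrightarrow> f x \<in> elems B"
  shows "\<exists>h. sk_hom h F B \<and> (\<forall>x \<in> X. h (gen x) = f x) \<and>
    (\<forall>h'. sk_hom h' F B \<and> (\<forall>x \<in> X. h' (gen x) = f x) \<longrightarrow> (\<forall>a \<in> elems F. h' a = h a))"
  unfolding F_def gen_def
proof (rule free_alg_universal_general)
  show "sk_algebra B"
    using B by (simp add: right_handed_sba_def skew_boolean_algebra_def skew_lattice_def)
  show "right_handed_sba A" if "sk_algebra A" "sk_separated ((=) B) A" for A :: "'v sk_term set sk_alg"
    by (rule right_handed_separated[OF that(1) sk_separated_mono[OF that(2)]]) (use B in simp)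
qed (rule right_handed_separated f; assumption)+

end

theory Submission
  imports Defs "HOL-Library.FuncSet"
begin

text \<open>The free skew Boolean algebra over a finite set \<open>X\<close> is the product, over all \<open>A \<subseteq> X\<close>, of
  primitive algebras: a zero together with one rectangular band \<open>A \<times> A\<close>. The factor at \<open>A\<close> is the
  part of the algebra that lies below the generators in \<open>A\<close> and is disjoint from the others.
  A generator \<open>x\<close> has the entry \<open>(x, x)\<close> at the sets containing \<open>x\<close> and zero elsewhere. In the
  left-handed and the right-handed variety one of the two coordinates collapses, so that the band
  has only \<open>card A\<close> elements. Hence an algebra of the first kind has
  \<open>\<Prod>A\<in>Pow X. (card A)\<^sup>2 + 1\<close> elements, one of the handed kinds \<open>\<Prod>A\<in>Pow X. card A + 1\<close>. Atoms have a
  single nonzero entry, so there are as many of them as nonzero entries in all factors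
  together. Grouping the subsets by cardinality yields the binomial coefficients.\<close>

text \<open>The product, called \<open>cell_alg\<close>, lies in the variety, which gives a homomorphism from
  the free algebra (\<open>free_alg_iso_cell_alg\<close>). It is surjective because the generators generate
  the product (\<open>cell_alg_generated\<close>). It is injective because terms with equal values in the product
  have equal values in every algebra of the variety (\<open>cell_alg_separates\<close>). For the latter, the
  defining identities are first shown to imply the normal law \<open>x \<sqinter> y \<sqinter> z \<sqinter> w = x \<sqinter> z \<sqinter> y \<sqinter> w\<close>
  (\<open>normality\<close>), so that meeting with an element \<open>e\<close> on either side respects meets. Splitting \<open>e\<close> into
  \<open>e \<sqinter> x \<sqinter> e\<close> and \<open>e \<setminus> x\<close> for each generator \<open>x\<close> leaves only elements \<open>e\<close> that are below or
  disjoint from each generator, and at such an \<open>e\<close> the value of a term is read off from one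
  factor of the product (\<open>cell_value_sk_eval\<close>).\<close>

section \<open>Normality of skew Boolean algebras\<close>

context skew_boolean_algebra
begin

lemma meet_idem: "x \<in> elems S \<Longrightarrow> x \<sqinter> x = x"
  by (metis join_absorb_left meet_absorb_left meet_closed)

lemma meet_left_idem: "x \<in> elems S \<Longrightarrow> y \<in> elems S \<Longrightarrow> x \<sqinter> (x \<sqinter> y) = x \<sqinter> y"
  by (metis meet_assoc meet_idem)

text \<open>If \<open>z \<le> x\<close> then \<open>x \<squnion> z = x = z \<squnion> x\<close>, so distributivity gives \<open>y = y \<squnion> (z \<sqinter> y)\<close> and
  \<open>y = (y \<sqinter> z) \<squnion> y\<close>. Absorption turns these into \<open>y \<sqinter> z \<sqinter> y = z \<sqinter> y\<close> and
  \<open>y \<sqinter> z \<sqinter> y = y \<sqinter> z\<close>.\<close>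

lemma lower_elements_commute:
  assumes el: "x \<in> elems S" "y \<in> elems S" "z \<in> elems S"
    and y: "x \<sqinter> y = y" "y \<sqinter> x = y" and z: "x \<sqinter> z = z" "z \<sqinter> x = z"
  shows "y \<sqinter> z = z \<sqinter> y"
proof -
  have "x \<squnion> z = x" "z \<squnion> x = x"
    using join_absorb_left[of x z] join_absorb_right[of x z] el z by simp_all
  hence "y = y \<squnion> z \<sqinter> y" "y = y \<sqinter> z \<squnion> y"
    using distrib_right[of x z y] distrib_left[of y z x] el y by simp_all
  hence "y \<sqinter> (z \<sqinter> y) = z \<sqinter> y" "y \<sqinter> z \<sqinter> y = y \<sqinter> z"
    using meet_absorb_right[of "z \<sqinter> y" y] meet_absorb_left[of "y \<sqinter> z" y] el meet_closed
    by metis+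
  thus ?thesis using el by (simp add: meet_assoc)
qed

text \<open>A band is a semilattice of rectangular bands, and \<open>u \<sqinter> a \<sqinter> u = u\<close> says that the
  class of \<open>u\<close> lies below that of \<open>a\<close>. The proof evaluates \<open>u \<sqinter> (c \<sqinter> c) \<sqinter> u = u \<sqinter> c \<sqinter> u\<close> for
  \<open>c = b \<sqinter> u \<sqinter> a\<close>.\<close>

lemma sandwiched_meet:
  assumes el: "u \<in> elems S" "a \<in> elems S" "b \<in> elems S"
    and a: "u \<sqinter> a \<sqinter> u = u" and b: "u \<sqinter> b \<sqinter> u = u"
  shows "u \<sqinter> (a \<sqinter> b) \<sqinter> u = u"
proof -
  have "(u \<sqinter> b \<sqinter> u) \<sqinter> (a \<sqinter> b) \<sqinter> (u \<sqinter> a \<sqinter> u) = u \<sqinter> ((b \<sqinter> u \<sqinter> a) \<sqinter> (b \<sqinter> u \<sqinter> a)) \<sqinter> u"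
    using el by (simp add: meet_assoc meet_closed)
  also have "\<dots> = (u \<sqinter> b \<sqinter> u) \<sqinter> a \<sqinter> u"
    using el by (simp add: meet_idem meet_closed) (simp add: meet_assoc meet_closed)
  finally show ?thesis by (simp only: a b)
qed

lemma sandwich_commute:
  assumes el: "x \<in> elems S" "y \<in> elems S" "z \<in> elems S"
  shows "x \<sqinter> y \<sqinter> x \<sqinter> z \<sqinter> x = x \<sqinter> z \<sqinter> x \<sqinter> y \<sqinter> x"
  using lower_elements_commute[of x "x \<sqinter> y \<sqinter> x" "x \<sqinter> z \<sqinter> x"] el
  by (simp add: meet_assoc meet_closed meet_idem meet_left_idem)

text \<open>Both sides lie in \<open>x \<sqinter> S \<sqinter> x\<close>, which is commutative. The left side is below the right one
  since it is fixed by meeting with \<open>x \<sqinter> y \<sqinter> x\<close> and \<open>x \<sqinter> z \<sqinter> x\<close>, and the two sides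
  lie in the same rectangular class by \<open>sandwiched_meet\<close>, so they agree.\<close>

lemma sandwich_split:
  assumes el: "x \<in> elems S" "y \<in> elems S" "z \<in> elems S"
  shows "x \<sqinter> y \<sqinter> z \<sqinter> x = x \<sqinter> y \<sqinter> x \<sqinter> z \<sqinter> x"
proof -
  define u where "u = x \<sqinter> y \<sqinter> x \<sqinter> z \<sqinter> x"
  define r where "r = x \<sqinter> y \<sqinter> z \<sqinter> x"
  have u_el: "u \<in> elems S" using el by (simp add: u_def meet_closed)
  have r_el: "r \<in> elems S" using el by (simp add: r_def meet_closed)
  note s = meet_assoc meet_closed meet_idem meet_left_idem
  have idem: "x \<sqinter> (y \<sqinter> (x \<sqinter> (z \<sqinter> (x \<sqinter> (y \<sqinter> (x \<sqinter> (z \<sqinter> x))))))) = u"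
    using meet_left_idem[of "x \<sqinter> y \<sqinter> x \<sqinter> z" x] el by (simp add: u_def s)
  have xyxy: "x \<sqinter> (y \<sqinter> (x \<sqinter> (y \<sqinter> t))) = x \<sqinter> (y \<sqinter> t)" if "t \<in> elems S" for t
    using meet_left_idem[of "x \<sqinter> y" t] el that by (simp add: s)
  have xzxz: "x \<sqinter> (z \<sqinter> (x \<sqinter> (z \<sqinter> t))) = x \<sqinter> (z \<sqinter> t)" if "t \<in> elems S" for t
    using meet_left_idem[of "x \<sqinter> z" t] el that by (simp add: s)
  have zxzx: "z \<sqinter> (x \<sqinter> (z \<sqinter> x)) = z \<sqinter> x"
    using meet_idem[of "z \<sqinter> x"] el by (simp add: meet_assoc meet_closed)
  have "u \<sqinter> y \<sqinter> u = u"
    using idem el xyxy by (simp add: u_def s)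
  moreover have "u \<sqinter> z \<sqinter> u = u"
    using idem el xzxz by (simp add: u_def s)
  ultimately have "u \<sqinter> (y \<sqinter> z) \<sqinter> u = u" using sandwiched_meet u_el el by simp
  hence uru: "u \<sqinter> r \<sqinter> u = u"
    using el by (simp add: u_def r_def s)
  have "(x \<sqinter> y \<sqinter> x) \<sqinter> r = r"
    using el xyxy by (simp add: r_def s)
  moreover have "(x \<sqinter> y \<sqinter> x) \<sqinter> r = r \<sqinter> (x \<sqinter> y \<sqinter> x)"
    using sandwich_commute[of x y "y \<sqinter> z"] el by (simp add: r_def s)
  moreover have "r \<sqinter> (x \<sqinter> z \<sqinter> x) = r"
    using el zxzx by (simp add: r_def s)
  moreover have "u = (x \<sqinter> y \<sqinter> x) \<sqinter> (x \<sqinter> z \<sqinter> x)"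
    using el by (simp add: u_def s)
  ultimately have ru: "r \<sqinter> u = r"
    using el r_el meet_assoc[of r "x \<sqinter> y \<sqinter> x" "x \<sqinter> z \<sqinter> x"]
    by (simp only: meet_closed)
  have "u \<sqinter> r = r \<sqinter> u"
    using lower_elements_commute[of x u r] el by (simp add: u_def r_def s)
  with uru ru have "u = r" using u_el r_el by (metis meet_assoc meet_idem)
  thus ?thesis by (simp add: u_def r_def)
qed

lemma sandwich_swap:
  assumes "x \<in> elems S" "y \<in> elems S" "z \<in> elems S"
  shows "x \<sqinter> y \<sqinter> z \<sqinter> x = x \<sqinter> z \<sqinter> y \<sqinter> x"
  using assms sandwich_split sandwich_commute by simp

text \<open>Idempotence doubles the word \<open>xyzw\<close>, which places \<open>yz\<close> once between two occurrences
  of \<open>x\<close> and once between two of \<open>w\<close>; there it may be swapped.\<close>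

lemma normality:
  assumes el: "x \<in> elems S" "y \<in> elems S" "z \<in> elems S" "w \<in> elems S"
  shows "x \<sqinter> (y \<sqinter> (z \<sqinter> w)) = x \<sqinter> (z \<sqinter> (y \<sqinter> w))"
proof -
  note s = meet_assoc meet_closed
  have sw: "c \<sqinter> (a \<sqinter> b) \<sqinter> c = c \<sqinter> (b \<sqinter> a) \<sqinter> c"
    if "a \<in> elems S" "b \<in> elems S" "c \<in> elems S" for a b c
    using sandwich_swap[of c a b] that by (simp add: s)
  have swap: "c \<sqinter> (a \<sqinter> (b \<sqinter> (d \<sqinter> c))) = c \<sqinter> (b \<sqinter> (a \<sqinter> (d \<sqinter> c)))"
    if e: "a \<in> elems S" "b \<in> elems S" "c \<in> elems S" "d \<in> elems S" for a b c d
  proof -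
    have "c \<sqinter> a \<sqinter> b \<sqinter> d \<sqinter> c = c \<sqinter> (a \<sqinter> b) \<sqinter> c \<sqinter> d \<sqinter> c"
      using sandwich_split[of c "a \<sqinter> b" d] e by (simp add: s)
    also have "\<dots> = c \<sqinter> (b \<sqinter> a) \<sqinter> c \<sqinter> d \<sqinter> c"
      using sw[OF e(1-3)] by simp
    also have "\<dots> = c \<sqinter> b \<sqinter> a \<sqinter> d \<sqinter> c"
      using sandwich_split[of c "b \<sqinter> a" d] e by (simp add: s)
    finally show ?thesis using e by (simp add: s)
  qed
  have "x \<sqinter> (y \<sqinter> (z \<sqinter> w)) = (x \<sqinter> (y \<sqinter> (z \<sqinter> (w \<sqinter> x)))) \<sqinter> (y \<sqinter> (z \<sqinter> w))"
    using meet_idem[of "x \<sqinter> y \<sqinter> z \<sqinter> w"] el by (simp add: s)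
  also have "\<dots> = x \<sqinter> (z \<sqinter> y) \<sqinter> (w \<sqinter> x \<sqinter> y \<sqinter> z \<sqinter> w)"
    using swap[of y z x w] el by (simp add: s)
  also have "w \<sqinter> x \<sqinter> y \<sqinter> z \<sqinter> w = w \<sqinter> x \<sqinter> z \<sqinter> y \<sqinter> w"
  proof -
    have "w \<sqinter> x \<sqinter> (y \<sqinter> z) \<sqinter> w = w \<sqinter> x \<sqinter> w \<sqinter> (y \<sqinter> z) \<sqinter> w"
      using sandwich_split[of w x "y \<sqinter> z"] el by (simp add: s)
    also have "\<dots> = w \<sqinter> x \<sqinter> w \<sqinter> (z \<sqinter> y) \<sqinter> w"
    proof -
      have "w \<sqinter> x \<sqinter> (w \<sqinter> (y \<sqinter> z) \<sqinter> w) = w \<sqinter> x \<sqinter> (w \<sqinter> (z \<sqinter> y) \<sqinter> w)"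
        using sw[OF el(2-4)] by simp
      thus ?thesis using el by (simp add: s)
    qed
    also have "\<dots> = w \<sqinter> x \<sqinter> (z \<sqinter> y) \<sqinter> w"
      using sandwich_split[of w x "z \<sqinter> y"] el by (simp add: s)
    finally show ?thesis using el by (simp add: s)
  qed
  also have "x \<sqinter> (z \<sqinter> y) \<sqinter> (w \<sqinter> x \<sqinter> z \<sqinter> y \<sqinter> w) = x \<sqinter> (z \<sqinter> (y \<sqinter> w))"
    using meet_idem[of "x \<sqinter> z \<sqinter> y \<sqinter> w"] el by (simp add: s)
  finally show ?thesis .
qed

lemma diff_below:
  assumes "x \<in> elems S" "y \<in> elems S"
  shows "x \<sqinter> (x \<setminus> y) = x \<setminus> y" and "(x \<setminus> y) \<sqinter> x = x \<setminus> y"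
proof -
  note cl = meet_closed diff_closed assms
  note x = diff_join[of x y, symmetric]
  show "x \<sqinter> (x \<setminus> y) = x \<setminus> y"
    using meet_absorb_right[of "x \<setminus> y" "x \<sqinter> y \<sqinter> x"] x cl by simp
  show "(x \<setminus> y) \<sqinter> x = x \<setminus> y"
    using distrib_left[of "x \<setminus> y" "x \<sqinter> y \<sqinter> x" "x \<setminus> y"] x diff_meet_left[of x y]
    by (simp add: cl meet_idem zero_join)
qed

lemma diff_disjoint:
  assumes "x \<in> elems S" "y \<in> elems S"
  shows "(x \<setminus> y) \<sqinter> y = \<zero>" and "y \<sqinter> (x \<setminus> y) = \<zero>"
proof -
  let ?d = "x \<setminus> y"
  note cl = meet_closed diff_closed assms
  have "?d \<sqinter> y \<sqinter> ?d = (?d \<sqinter> x) \<sqinter> y \<sqinter> (x \<sqinter> ?d)" by (simp add: diff_below assms)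
  also have "\<dots> = \<zero>" using diff_meet_left[of x y]
      meet_assoc[of ?d "x \<sqinter> y \<sqinter> x" ?d] zero_meet[of ?d]
    by (simp add: cl meet_assoc)
  finally have 0: "?d \<sqinter> y \<sqinter> ?d = \<zero>" .
  have "?d \<sqinter> y = (?d \<sqinter> y \<sqinter> ?d) \<sqinter> y" using meet_idem[of "?d \<sqinter> y"] cl by (simp add: meet_assoc)
  thus "?d \<sqinter> y = \<zero>" using 0 assms by (simp add: zero_meet)
  have "y \<sqinter> ?d = y \<sqinter> (?d \<sqinter> y \<sqinter> ?d)" using meet_idem[of "y \<sqinter> ?d"] cl by (simp add: meet_assoc)
  thus "y \<sqinter> ?d = \<zero>" using 0 assms by (simp add: meet_zero)
qed

end

section \<open>A product of primitive algebras\<close>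

text \<open>The primitive skew Boolean algebra on \<open>P \<times> Q\<close> consists of the rectangular band \<open>P \<times> Q\<close>,
  with the join the opposite of the meet, and a zero, rendered as \<open>None\<close>.\<close>

fun cell_meet :: "('p \<times> 'q) option \<Rightarrow> ('p \<times> 'q) option \<Rightarrow> ('p \<times> 'q) option" where
  "cell_meet (Some (a, b)) (Some (c, d)) = Some (a, d)"
| "cell_meet None y = None"
| "cell_meet x None = None"

fun cell_join :: "('p \<times> 'q) option \<Rightarrow> ('p \<times> 'q) option \<Rightarrow> ('p \<times> 'q) option" where
  "cell_join (Some (a, b)) (Some (c, d)) = Some (c, b)"
| "cell_join None y = y"
| "cell_join x None = x"

fun cell_diff :: "('p \<times> 'q) option \<Rightarrow> ('p \<times> 'q) option \<Rightarrow> ('p \<times> 'q) option" where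
  "cell_diff x (Some y) = None"
| "cell_diff x None = x"

lemma cell_meet_None [simp]: "cell_meet x None = None" by (cases x) auto
lemma cell_join_None [simp]: "cell_join x None = x" by (cases x) auto

text \<open>Entries at sets outside \<open>Pow X\<close> are forced to be zero, so that the algebra operations can be
  plainly pointwise and equality of elements is equality of functions.\<close>

definition cells :: "('v \<Rightarrow> 'p) \<Rightarrow> ('v \<Rightarrow> 'q) \<Rightarrow> 'v set \<Rightarrow> 'v set \<Rightarrow> ('p \<times> 'q) option set" where
  "cells l r X A = {c. \<forall>p q. c = Some (p, q) \<longrightarrow> A \<subseteq> X \<and> p \<in> l ` A \<and> q \<in> r ` A}"

text \<open>The product over all \<open>A \<subseteq> X\<close> of the primitive algebras on \<open>l ` A \<times> r ` A\<close>. The maps \<open>l\<close> and \<open>r\<close>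
  treat the three varieties at once: the identity keeps a coordinate and a constant map
  trivialises it. The empty set contributes a trivial factor.\<close>

definition cell_alg ::
    "('v \<Rightarrow> 'p) \<Rightarrow> ('v \<Rightarrow> 'q) \<Rightarrow> 'v set \<Rightarrow> ('v set \<Rightarrow> ('p \<times> 'q) option) sk_alg" where
  "cell_alg l r X = \<lparr>
     elems = {m. \<forall>A. m A \<in> cells l r X A},
     sk_meet = (\<lambda>m m' A. cell_meet (m A) (m' A)),
     sk_join = (\<lambda>m m' A. cell_join (m A) (m' A)),
     sk_diff = (\<lambda>m m' A. cell_diff (m A) (m' A)),
     sk_zero = (\<lambda>A. None)\<rparr>"

definition cell_gen ::
    "('v \<Rightarrow> 'p) \<Rightarrow> ('v \<Rightarrow> 'q) \<Rightarrow> 'v set \<Rightarrow> 'v \<Rightarrow> 'v set \<Rightarrow> ('p \<times> 'q) option" where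
  "cell_gen l r X x = (\<lambda>A. if A \<subseteq> X \<and> x \<in> A then Some (l x, r x) else None)"

lemma cell_alg_simps [simp]:
  "m \<in> elems (cell_alg l r X) \<longleftrightarrow> (\<forall>A. m A \<in> cells l r X A)"
  "m \<sqinter>\<^bsub>cell_alg l r X\<^esub> m' = (\<lambda>A. cell_meet (m A) (m' A))"
  "m \<squnion>\<^bsub>cell_alg l r X\<^esub> m' = (\<lambda>A. cell_join (m A) (m' A))"
  "m \<setminus>\<^bsub>cell_alg l r X\<^esub> m' = (\<lambda>A. cell_diff (m A) (m' A))"
  "\<zero>\<^bsub>cell_alg l r X\<^esub> = (\<lambda>A. None)"
  by (simp_all add: cell_alg_def)

lemma cells_closed:
  "c \<in> cells l r X A \<Longrightarrow> d \<in> cells l r X A \<Longrightarrow> cell_meet c d \<in> cells l r X A"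
  "c \<in> cells l r X A \<Longrightarrow> d \<in> cells l r X A \<Longrightarrow> cell_join c d \<in> cells l r X A"
  "c \<in> cells l r X A \<Longrightarrow> cell_diff c d \<in> cells l r X A"
  "None \<in> cells l r X A"
  by (cases c; cases d; auto simp: cells_def)+

lemma cell_gen_closed: "cell_gen l r X x \<in> elems (cell_alg l r X)"
  by (auto simp: cell_gen_def cells_def)

lemma cell_meet_laws:
  "cell_meet (cell_meet x y) z = cell_meet x (cell_meet y z)"
  "cell_meet x (cell_join x y) = x"
  "cell_meet (cell_join y x) x = x"
  "cell_meet x (cell_join y z) = cell_join (cell_meet x y) (cell_meet x z)"
  "cell_meet (cell_join x y) z = cell_join (cell_meet x z) (cell_meet y z)"
  by (cases x; cases y; cases z; auto)+

lemma cell_join_laws: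
  "cell_join (cell_join x y) z = cell_join x (cell_join y z)"
  "cell_join x (cell_meet x y) = x"
  "cell_join (cell_meet y x) x = x"
  by (cases x; cases y; cases z; auto)+

lemma cell_diff_laws:
  "cell_join (cell_meet x (cell_meet y x)) (cell_diff x y) = x"
  "cell_meet x (cell_meet y (cell_meet x (cell_diff x y))) = None"
  "cell_meet (cell_diff x y) (cell_meet x (cell_meet y x)) = None"
  by (cases x; cases y; auto)+

lemma cell_alg_sba: "skew_boolean_algebra (cell_alg l r X)"
  by unfold_locales
    (simp_all only: cell_alg_simps cells_closed cell_meet_laws cell_join_laws cell_diff_laws
      cell_meet.simps cell_join.simps cell_meet_None cell_join_None simp_thms)

lemma cell_alg_left_handed:
  assumes r: "\<And>x y. r x = r y"
  shows "left_handed_sba (cell_alg l r X)"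
proof -
  interpret skew_boolean_algebra "cell_alg l r X" by (rule cell_alg_sba)
  have m: "cell_meet (cell_meet c d) c = cell_meet c d"
    and j: "cell_join (cell_join c d) c = cell_join d c"
    if "c \<in> cells l r X A" "d \<in> cells l r X A" for c d A
    using that by (cases c; cases d; auto simp: cells_def intro: r)+
  show ?thesis by unfold_locales (simp_all add: fun_eq_iff, (blast intro: m j)+)
qed

lemma cell_alg_right_handed:
  assumes l: "\<And>x y. l x = l y"
  shows "right_handed_sba (cell_alg l r X)"
proof -
  interpret skew_boolean_algebra "cell_alg l r X" by (rule cell_alg_sba)
  have m: "cell_meet (cell_meet c d) c = cell_meet d c"
    and j: "cell_join (cell_join c d) c = cell_join c d"
    if "c \<in> cells l r X A" "d \<in> cells l r X A" for c d A
    using that by (cases c; cases d; auto simp: cells_def intro: l)+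
  show ?thesis by unfold_locales (simp_all add: fun_eq_iff, (blast intro: m j)+)
qed

text \<open>An element of the model is the join of its entries, so it suffices to generate an element
  with the single entry \<open>(l a, r b)\<close> at \<open>A\<close>. The meet of the generators \<open>a\<close> and \<open>b\<close> has this
  entry at every set containing both; its support is cut down to \<open>A\<close> by meeting with
  the generators in \<open>A\<close> and subtracting those outside.\<close>

lemma cell_alg_generated:
  assumes X: "finite X" and m: "m \<in> elems (cell_alg l r X)"
  shows "m \<in> sk_eval (cell_alg l r X) (cell_gen l r X) ` {t. set_sk_term t \<subseteq> X}"
proof -
  let ?M = "cell_alg l r X" and ?g = "cell_gen l r X"
  define G where "G = sk_eval ?M ?g ` {t. set_sk_term t \<subseteq> X}"
  have zero: "(\<lambda>A. None) \<in> G"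
    unfolding G_def by (rule image_eqI[of _ _ Zero]) auto
  have gen: "?g x \<in> G" if "x \<in> X" for x
    unfolding G_def by (rule image_eqI[of _ _ "Gen x"]) (use that in auto)
  have meet: "(\<lambda>A. cell_meet (u A) (v A)) \<in> G" if uv: "u \<in> G" "v \<in> G" for u v
  proof -
    from uv obtain s t where "set_sk_term s \<subseteq> X" "u = sk_eval ?M ?g s"
      "set_sk_term t \<subseteq> X" "v = sk_eval ?M ?g t" by (auto simp: G_def)
    thus ?thesis unfolding G_def by (intro image_eqI[of _ _ "Meet s t"]) auto
  qed
  have join: "(\<lambda>A. cell_join (u A) (v A)) \<in> G" if uv: "u \<in> G" "v \<in> G" for u v
  proof -
    from uv obtain s t where "set_sk_term s \<subseteq> X" "u = sk_eval ?M ?g s"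
      "set_sk_term t \<subseteq> X" "v = sk_eval ?M ?g t" by (auto simp: G_def)
    thus ?thesis unfolding G_def by (intro image_eqI[of _ _ "Join s t"]) auto
  qed
  have diff: "(\<lambda>A. cell_diff (u A) (v A)) \<in> G" if uv: "u \<in> G" "v \<in> G" for u v
  proof -
    from uv obtain s t where "set_sk_term s \<subseteq> X" "u = sk_eval ?M ?g s"
      "set_sk_term t \<subseteq> X" "v = sk_eval ?M ?g t" by (auto simp: G_def)
    thus ?thesis unfolding G_def by (intro image_eqI[of _ _ "Diff s t"]) auto
  qed
  have single: "(\<lambda>C. if C = A then Some (l a, r b) else None) \<in> G"
    if A: "A \<subseteq> X" "a \<in> A" "b \<in> A" for A a b
  proof -
    have "(\<lambda>C. if C \<subseteq> X \<and> {a, b} \<subseteq> C \<and> C \<inter> Y = A \<inter> Y then Some (l a, r b) else None) \<in> G"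
      if "finite Y" "Y \<subseteq> X" for Y
      using that
    proof (induction Y)
      case empty
      have "(\<lambda>C. cell_meet (?g a C) (?g b C)) \<in> G" using A by (intro meet gen) auto
      moreover have "(\<lambda>C. cell_meet (?g a C) (?g b C)) =
          (\<lambda>C. if C \<subseteq> X \<and> {a, b} \<subseteq> C \<and> C \<inter> {} = A \<inter> {} then Some (l a, r b) else None)"
        by (auto simp: cell_gen_def fun_eq_iff)
      ultimately show ?case by simp
    next
      case (insert x Y)
      define y where "y = (\<lambda>C.
        if C \<subseteq> X \<and> {a, b} \<subseteq> C \<and> C \<inter> Y = A \<inter> Y then Some (l a, r b) else None)"
      have y: "y \<in> G" using insert by (simp add: y_def)
      have x: "?g x \<in> G" using insert by (intro gen) auto
      show ?case
      proof (cases "x \<in> A")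
        case True
        \<comment> \<open>The outer occurrences of \<open>y\<close> restore both coordinates, so only the support shrinks.\<close>
        have "(\<lambda>C. cell_meet (cell_meet (y C) (?g x C)) (y C)) =
            (\<lambda>C. if C \<subseteq> X \<and> {a, b} \<subseteq> C \<and> C \<inter> insert x Y = A \<inter> insert x Y
              then Some (l a, r b) else None)"
          using True insert(2) by (auto simp: y_def cell_gen_def fun_eq_iff)
        with meet[OF meet[OF y x] y] show ?thesis by simp
      next
        case False
        have "(\<lambda>C. cell_diff (y C) (?g x C)) =
            (\<lambda>C. if C \<subseteq> X \<and> {a, b} \<subseteq> C \<and> C \<inter> insert x Y = A \<inter> insert x Y
              then Some (l a, r b) else None)"
          using False insert(2) by (auto simp: y_def cell_gen_def fun_eq_iff)
        with diff[OF y x] show ?thesis by simp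
      qed
    qed
    from this[OF X order_refl]
    have "(\<lambda>C. if C \<subseteq> X \<and> {a, b} \<subseteq> C \<and> C \<inter> X = A \<inter> X then Some (l a, r b) else None) \<in> G" .
    moreover have "C \<subseteq> X \<and> {a, b} \<subseteq> C \<and> C \<inter> X = A \<inter> X \<longleftrightarrow> C = A" for C
      using A by auto
    ultimately show ?thesis by simp
  qed
  have "(\<lambda>C. if C \<in> \<A> then m C else None) \<in> G" if "finite \<A>" "\<A> \<subseteq> Pow X" for \<A>
    using that
  proof (induction \<A>)
    case empty
    show ?case using zero by simp
  next
    case (insert A \<A>)
    define u where "u = (\<lambda>C. if C \<in> \<A> then m C else None)"
    have u: "u \<in> G" using insert by (simp add: u_def)
    show ?case
    proof (cases "m A")
      case None
      have "u = (\<lambda>C. if C \<in> insert A \<A> then m C else None)"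
        using None by (auto simp: u_def fun_eq_iff)
      with u show ?thesis by simp
    next
      case (Some pq)
      then obtain p q where pq: "m A = Some (p, q)" by (cases pq) auto
      moreover have "m A \<in> cells l r X A" using m by simp
      ultimately obtain a b where ab: "A \<subseteq> X" "a \<in> A" "b \<in> A" "p = l a" "q = r b"
        by (auto simp: cells_def)
      have "(\<lambda>C. cell_join (u C) (if C = A then Some (l a, r b) else None)) =
          (\<lambda>C. if C \<in> insert A \<A> then m C else None)"
        using insert(2) pq ab by (auto simp: u_def fun_eq_iff)
      with join[OF u single[OF ab(1-3)]] show ?thesis by simp
    qed
  qed
  from this[of "Pow X"] have "(\<lambda>C. if C \<subseteq> X then m C else None) \<in> G" using X by simp
  moreover have "m C = None" if "\<not> C \<subseteq> X" for C
    using m that by (cases "m C") (auto simp: cells_def)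
  hence "(\<lambda>C. if C \<subseteq> X then m C else None) = m" by (auto simp: fun_eq_iff)
  ultimately show ?thesis by (simp add: G_def)
qed

section \<open>Agreement of two elements below a third\<close>

context skew_boolean_algebra
begin

text \<open>If the class of \<open>u\<close> lies above that of \<open>e\<close>, then \<open>e \<sqinter> u\<close> and \<open>u \<sqinter> e\<close> lie in the rectangular
  class of \<open>e\<close>; the former takes its second and the latter its first coordinate from \<open>u\<close>.
  Both are compared, since each of them forgets the other coordinate.\<close>

definition agree :: "'a \<Rightarrow> 'a \<Rightarrow> 'a \<Rightarrow> bool" where
  "agree e u v \<longleftrightarrow> e \<sqinter> u = e \<sqinter> v \<and> u \<sqinter> e = v \<sqinter> e"

text \<open>Each \<open>x\<close> splits \<open>e\<close> into \<open>e \<sqinter> x \<sqinter> e\<close> and \<open>e \<setminus> x\<close>; an element decides \<open>x\<close> if one of the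
  two parts is all of it, that is, if it lies in the class below that of \<open>x\<close> or is disjoint
  from \<open>x\<close>.\<close>

definition decides :: "'a \<Rightarrow> 'a \<Rightarrow> bool" where
  "decides e x \<longleftrightarrow> e \<sqinter> x \<sqinter> e = e \<or> e \<sqinter> x = \<zero> \<and> x \<sqinter> e = \<zero>"

lemma decides_meet:
  assumes "e \<in> elems S" "x \<in> elems S" "y \<in> elems S" "decides e x"
  shows "decides (e \<sqinter> y \<sqinter> e) x"
  using assms(4) unfolding decides_def
proof (elim disjE conjE)
  assume x: "e \<sqinter> x \<sqinter> e = e"
  have "e \<sqinter> y \<sqinter> e \<sqinter> x \<sqinter> (e \<sqinter> y \<sqinter> e) = e \<sqinter> y \<sqinter> (e \<sqinter> x \<sqinter> e) \<sqinter> y \<sqinter> e"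
    using assms by (simp add: meet_assoc meet_closed)
  also have "\<dots> = e \<sqinter> y \<sqinter> e"
    unfolding x using meet_left_idem[of "e \<sqinter> y" e] assms by (simp add: meet_assoc meet_closed)
  finally show "e \<sqinter> y \<sqinter> e \<sqinter> x \<sqinter> (e \<sqinter> y \<sqinter> e) = e \<sqinter> y \<sqinter> e \<or>
    e \<sqinter> y \<sqinter> e \<sqinter> x = \<zero> \<and> x \<sqinter> (e \<sqinter> y \<sqinter> e) = \<zero>" ..
next
  assume x: "e \<sqinter> x = \<zero>" "x \<sqinter> e = \<zero>"
  have "e \<sqinter> y \<sqinter> e \<sqinter> x = e \<sqinter> y \<sqinter> (e \<sqinter> x)" "x \<sqinter> (e \<sqinter> y \<sqinter> e) = (x \<sqinter> e) \<sqinter> (y \<sqinter> e)"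
    using assms by (simp_all add: meet_assoc meet_closed)
  thus "e \<sqinter> y \<sqinter> e \<sqinter> x \<sqinter> (e \<sqinter> y \<sqinter> e) = e \<sqinter> y \<sqinter> e \<or>
    e \<sqinter> y \<sqinter> e \<sqinter> x = \<zero> \<and> x \<sqinter> (e \<sqinter> y \<sqinter> e) = \<zero>"
    using assms by (simp add: x meet_closed zero_meet meet_zero)
qed

lemma decides_diff:
  assumes "e \<in> elems S" "x \<in> elems S" "y \<in> elems S" "decides e x"
  shows "decides (e \<setminus> y) x"
proof -
  let ?d = "e \<setminus> y"
  note d = diff_below[OF assms(1,3)]
  note cl = assms(1-3) meet_closed diff_closed
  from assms(4) show ?thesis unfolding decides_def
  proof (elim disjE conjE)
    assume x: "e \<sqinter> x \<sqinter> e = e"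
    have "?d \<sqinter> x \<sqinter> ?d = (?d \<sqinter> e) \<sqinter> x \<sqinter> (e \<sqinter> ?d)" by (simp only: d)
    also have "\<dots> = ?d \<sqinter> (e \<sqinter> x \<sqinter> e) \<sqinter> ?d" using cl by (simp add: meet_assoc)
    also have "\<dots> = ?d" using cl by (simp add: x d meet_idem)
    finally show "?d \<sqinter> x \<sqinter> ?d = ?d \<or> ?d \<sqinter> x = \<zero> \<and> x \<sqinter> ?d = \<zero>" ..
  next
    assume x: "e \<sqinter> x = \<zero>" "x \<sqinter> e = \<zero>"
    have "?d \<sqinter> x = ?d \<sqinter> (e \<sqinter> x)" "x \<sqinter> ?d = (x \<sqinter> e) \<sqinter> ?d"
      using cl by (simp_all add: d meet_assoc[symmetric]) (simp add: meet_assoc d)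
    thus "?d \<sqinter> x \<sqinter> ?d = ?d \<or> ?d \<sqinter> x = \<zero> \<and> x \<sqinter> ?d = \<zero>"
      using cl by (simp add: x zero_meet meet_zero)
  qed
qed

lemma decides_meet_self:
  assumes "e \<in> elems S" "y \<in> elems S"
  shows "decides (e \<sqinter> y \<sqinter> e) y"
proof -
  have "e \<sqinter> y \<sqinter> e \<sqinter> y \<sqinter> (e \<sqinter> y \<sqinter> e) = ((e \<sqinter> y) \<sqinter> (e \<sqinter> y) \<sqinter> (e \<sqinter> y)) \<sqinter> e"
    using assms by (simp add: meet_assoc meet_closed)
  also have "\<dots> = e \<sqinter> y \<sqinter> e" using assms by (simp only: meet_idem meet_closed)
  finally show ?thesis unfolding decides_def ..
qed

lemma decides_diff_self:
  "e \<in> elems S \<Longrightarrow> y \<in> elems S \<Longrightarrow> decides (e \<setminus> y) y"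
  by (simp add: decides_def diff_disjoint)

text \<open>Agreement passes from the two parts to \<open>e\<close>, since \<open>e\<close> is their join and meet distributes
  over join.\<close>

lemma agree_split:
  assumes el: "e \<in> elems S" "y \<in> elems S" "u \<in> elems S" "v \<in> elems S"
    and ag: "agree (e \<sqinter> y \<sqinter> e) u v" "agree (e \<setminus> y) u v"
  shows "agree e u v"
proof -
  let ?p = "e \<sqinter> y \<sqinter> e" and ?d = "e \<setminus> y"
  have cl: "?p \<in> elems S" "?d \<in> elems S" using el by (simp_all add: meet_closed diff_closed)
  have "(?p \<squnion> ?d) \<sqinter> u = (?p \<squnion> ?d) \<sqinter> v" "u \<sqinter> (?p \<squnion> ?d) = v \<sqinter> (?p \<squnion> ?d)"
    using ag cl el by (simp_all only: agree_def distrib_left distrib_right)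
  thus ?thesis using diff_join[of e y] el by (simp add: agree_def)
qed

text \<open>Normality makes meeting with a fixed element, on either side, an endomorphism of the
  meet operation.\<close>

lemma meet_insert_left:
  assumes "e \<in> elems S" "u \<in> elems S" "v \<in> elems S"
  shows "e \<sqinter> (u \<sqinter> v) = (e \<sqinter> u) \<sqinter> (e \<sqinter> v)"
  using normality[of e u e v] meet_left_idem[of e "u \<sqinter> v"] assms by (simp add: meet_assoc meet_closed)

lemma meet_insert_right:
  assumes "e \<in> elems S" "u \<in> elems S" "v \<in> elems S"
  shows "(u \<sqinter> v) \<sqinter> e = (u \<sqinter> e) \<sqinter> (v \<sqinter> e)"
  using normality[of u e v e] meet_idem[of e] assms by (simp add: meet_assoc meet_closed)

text \<open>Two elements that agree at both of them are equal, since \<open>u = u \<sqinter> u = u \<sqinter> v\<close> and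
  \<open>u \<sqinter> v = v \<sqinter> v = v\<close>.\<close>

lemma agree_imp_eq:
  assumes "u \<in> elems S" "v \<in> elems S" "agree u u v" "agree v u v"
  shows "u = v"
proof -
  have "u = u \<sqinter> v" using assms by (simp add: agree_def meet_idem)
  also have "\<dots> = v" using assms by (simp add: agree_def meet_idem)
  finally show ?thesis .
qed

section \<open>Evaluating terms at a deciding element\<close>

text \<open>The algebraic meaning of the entry \<open>c\<close> of a model element, for an \<open>e\<close> that lies below the
  generators indexed by \<open>A\<close> and is disjoint from the others: either \<open>u\<close> is disjoint from \<open>e\<close>, or
  the entry names two generators, one for each side, which meets with \<open>e\<close> on that side do not
  distinguish from \<open>u\<close>.\<close>

definition cell_value ::
    "('v \<Rightarrow> 'a) \<Rightarrow> ('v \<Rightarrow> 'p) \<Rightarrow> ('v \<Rightarrow> 'q) \<Rightarrow> 'v set \<Rightarrow> 'a \<Rightarrow> 'a \<Rightarrow> ('p \<times> 'q) option \<Rightarrow> bool" where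
  "cell_value f l r A e u c \<longleftrightarrow> (case c of
     None \<Rightarrow> e \<sqinter> u = \<zero> \<and> u \<sqinter> e = \<zero>
   | Some (p, q) \<Rightarrow> (\<exists>a\<in>A. l a = p \<and> u \<sqinter> e = f a \<sqinter> e) \<and> (\<exists>b\<in>A. r b = q \<and> e \<sqinter> u = e \<sqinter> f b))"

context
  fixes f :: "'v \<Rightarrow> 'a" and A :: "'v set" and e :: 'a
  assumes e: "e \<in> elems S"
    and f: "\<And>a. a \<in> A \<Longrightarrow> f a \<in> elems S"
    and on: "\<And>a. a \<in> A \<Longrightarrow> e \<sqinter> f a \<sqinter> e = e"
begin

text \<open>Below \<open>e\<close> the meet \<open>e \<sqinter> f b \<sqinter> e \<sqinter> f b'\<close> collapses to \<open>e \<sqinter> f b'\<close>, as in a rectangular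
  band; this is why the operations act on names by the rules of the model.\<close>

lemma on_left: "a \<in> A \<Longrightarrow> t \<in> elems S \<Longrightarrow> e \<sqinter> (f a \<sqinter> (e \<sqinter> t)) = e \<sqinter> t"
  using on[of a] e f[of a] by (metis meet_assoc meet_closed)

lemma cell_value_meet:
  assumes u: "u \<in> elems S" and v: "v \<in> elems S"
    and c: "cell_value f l r A e u c" and d: "cell_value f l r A e v d"
  shows "cell_value f l r A e (u \<sqinter> v) (cell_meet c d)"
proof (cases "c = None \<or> d = None")
  case True
  hence "cell_meet c d = None" by (cases c) auto
  moreover have "e \<sqinter> (u \<sqinter> v) = \<zero>" "(u \<sqinter> v) \<sqinter> e = \<zero>"
    using True c d e u v meet_insert_left[OF e u v] meet_insert_right[OF e u v]
    by (auto simp: cell_value_def zero_meet meet_zero meet_closed)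
  ultimately show ?thesis by (simp add: cell_value_def)
next
  case False
  then obtain p q p' q' where cd: "c = Some (p, q)" "d = Some (p', q')" by auto
  from c obtain a b where ab: "a \<in> A" "l a = p" "u \<sqinter> e = f a \<sqinter> e"
    "b \<in> A" "r b = q" "e \<sqinter> u = e \<sqinter> f b"
    by (auto simp: cell_value_def cd)
  from d obtain a' b' where ab': "a' \<in> A" "l a' = p'" "v \<sqinter> e = f a' \<sqinter> e"
    "b' \<in> A" "r b' = q'" "e \<sqinter> v = e \<sqinter> f b'"
    by (auto simp: cell_value_def cd)
  have "e \<sqinter> (u \<sqinter> v) = e \<sqinter> f b'"
    using meet_insert_left[OF e u v] ab ab' on_left[OF ab(4), of "f b'"] e f
    by (simp add: meet_assoc meet_closed)
  moreover have "(u \<sqinter> v) \<sqinter> e = f a \<sqinter> e"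
    using meet_insert_right[OF e u v] ab ab' on[OF ab'(1)] e f
    by (simp add: meet_assoc meet_closed)
  ultimately show ?thesis using ab ab' by (auto simp: cell_value_def cd)
qed

lemma cell_value_join:
  assumes u: "u \<in> elems S" and v: "v \<in> elems S"
    and c: "cell_value f l r A e u c" and d: "cell_value f l r A e v d"
  shows "cell_value f l r A e (u \<squnion> v) (cell_join c d)"
proof (cases "c = None \<or> d = None")
  case True
  thus ?thesis
    using c d e u v
    by (auto simp: cell_value_def distrib_left distrib_right zero_join join_zero meet_closed zero_closed
        split: option.splits)
next
  case False
  then obtain p q p' q' where cd: "c = Some (p, q)" "d = Some (p', q')" by auto
  from c obtain a b where ab: "a \<in> A" "l a = p" "u \<sqinter> e = f a \<sqinter> e"
    "b \<in> A" "r b = q" "e \<sqinter> u = e \<sqinter> f b"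
    by (auto simp: cell_value_def cd)
  from d obtain a' b' where ab': "a' \<in> A" "l a' = p'" "v \<sqinter> e = f a' \<sqinter> e"
    "b' \<in> A" "r b' = q'" "e \<sqinter> v = e \<sqinter> f b'"
    by (auto simp: cell_value_def cd)
  have "(e \<sqinter> f b) \<sqinter> (e \<sqinter> f b') = e \<sqinter> f b'"
    using on_left[OF ab(4), of "f b'"] ab' e f ab by (simp add: meet_assoc meet_closed)
  hence "e \<sqinter> f b \<squnion> e \<sqinter> f b' = e \<sqinter> f b"
    using join_absorb_left[of "e \<sqinter> f b" "e \<sqinter> f b'"] e f ab ab' by (simp add: meet_closed)
  hence 1: "e \<sqinter> (u \<squnion> v) = e \<sqinter> f b"
    using distrib_left[OF e u v] ab ab' by simp
  have "(f a \<sqinter> e) \<sqinter> (f a' \<sqinter> e) = f a \<sqinter> e"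
    using on[OF ab'(1)] ab ab' e f by (simp add: meet_assoc meet_closed)
  hence "f a \<sqinter> e \<squnion> f a' \<sqinter> e = f a' \<sqinter> e"
    using join_absorb_right[of "f a' \<sqinter> e" "f a \<sqinter> e"] e f ab ab' by (simp add: meet_closed)
  hence 2: "(u \<squnion> v) \<sqinter> e = f a' \<sqinter> e"
    using distrib_right[OF u v e] ab ab' by simp
  show ?thesis using 1 2 ab ab' by (auto simp: cell_value_def cd)
qed

lemma cell_value_diff:
  assumes u: "u \<in> elems S" and v: "v \<in> elems S"
    and c: "cell_value f l r A e u c" and d: "cell_value f l r A e v d"
  shows "cell_value f l r A e (u \<setminus> v) (cell_diff c d)"
proof (cases d)
  case None
  hence ev: "e \<sqinter> v = \<zero>" "v \<sqinter> e = \<zero>" using d by (simp_all add: cell_value_def)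
  note cl = meet_closed diff_closed e u v
  have "e \<sqinter> (u \<sqinter> v \<sqinter> u) = \<zero>" "(u \<sqinter> v \<sqinter> u) \<sqinter> e = \<zero>"
    using meet_insert_left[of e "u \<sqinter> v" u] meet_insert_left[of e u v]
      meet_insert_right[of e "u \<sqinter> v" u] meet_insert_right[of e u v] ev cl
    by (simp_all add: zero_meet meet_zero)
  hence "e \<sqinter> (u \<sqinter> v \<sqinter> u \<squnion> (u \<setminus> v)) = e \<sqinter> (u \<setminus> v)"
    "(u \<sqinter> v \<sqinter> u \<squnion> (u \<setminus> v)) \<sqinter> e = (u \<setminus> v) \<sqinter> e"
    using cl by (simp_all add: distrib_left distrib_right zero_join)
  hence "e \<sqinter> (u \<setminus> v) = e \<sqinter> u" "(u \<setminus> v) \<sqinter> e = u \<sqinter> e"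
    using diff_join[OF u v] by simp_all
  thus ?thesis using c None by (auto simp: cell_value_def split: option.splits)
next
  case (Some p)
  then obtain a b where ab: "a \<in> A" "v \<sqinter> e = f a \<sqinter> e" "b \<in> A" "e \<sqinter> v = e \<sqinter> f b"
    using d by (cases p) (auto simp: cell_value_def)
  note cl = meet_closed diff_closed e u v f
  have eve: "e \<sqinter> v \<sqinter> e = e" using on[OF ab(3)] ab by simp
  have "e \<sqinter> (u \<setminus> v) = (e \<sqinter> v \<sqinter> e) \<sqinter> (u \<setminus> v)" by (simp only: eve)
  also have "\<dots> = e \<sqinter> (v \<sqinter> (u \<setminus> v))"
    using meet_insert_left[of e v "u \<setminus> v"] cl by (simp add: meet_assoc)
  finally have 1: "e \<sqinter> (u \<setminus> v) = \<zero>" using diff_disjoint[OF u v] e by (simp add: meet_zero)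
  have "(u \<setminus> v) \<sqinter> e = (u \<setminus> v) \<sqinter> (e \<sqinter> v \<sqinter> e)" by (simp only: eve)
  also have "\<dots> = ((u \<setminus> v) \<sqinter> v) \<sqinter> e"
    using meet_insert_right[of e "u \<setminus> v" v] cl by (simp add: meet_assoc)
  finally have 2: "(u \<setminus> v) \<sqinter> e = \<zero>" using diff_disjoint[OF u v] e by (simp add: zero_meet)
  show ?thesis using 1 2 Some by (simp add: cell_value_def)
qed

end

lemma sk_eval_closed:
  assumes "\<And>x. x \<in> X \<Longrightarrow> f x \<in> elems S" "set_sk_term t \<subseteq> X"
  shows "sk_eval S f t \<in> elems S"
  using assms(2)
  by (induction t) (auto intro: assms(1) meet_closed join_closed diff_closed zero_closed)

lemma cell_value_sk_eval:
  assumes e: "e \<in> elems S" and f: "\<And>x. x \<in> X \<Longrightarrow> f x \<in> elems S" and A: "A \<subseteq> X"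
    and on: "\<And>a. a \<in> A \<Longrightarrow> e \<sqinter> f a \<sqinter> e = e"
    and off: "\<And>x. x \<in> X - A \<Longrightarrow> e \<sqinter> f x = \<zero> \<and> f x \<sqinter> e = \<zero>"
    and t: "set_sk_term t \<subseteq> X"
  shows "cell_value f l r A e (sk_eval S f t) (sk_eval (cell_alg l r X) (cell_gen l r X) t A)"
proof -
  have fA: "\<And>a. a \<in> A \<Longrightarrow> f a \<in> elems S" using f A by auto
  have cl: "sk_eval S f t \<in> elems S" if "set_sk_term t \<subseteq> X" for t
    using sk_eval_closed[of X f] f that by blast
  show ?thesis using t
  proof (induction t)
    case (Gen x)
    thus ?case using off A by (auto simp: cell_value_def cell_gen_def)
  next
    case Zero
    show ?case using e by (simp add: cell_value_def zero_meet meet_zero)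
  next
    case (Meet s t)
    thus ?case by (auto intro!: cell_value_meet[where f=f and A=A and e=e, OF e fA on cl cl])
  next
    case (Join s t)
    thus ?case by (auto intro!: cell_value_join[where f=f and A=A and e=e, OF e fA on cl cl])
  next
    case (Diff s t)
    thus ?case by (auto intro!: cell_value_diff[where f=f and A=A and e=e, OF e fA on cl cl])
  qed
qed

text \<open>The two sides agree at every element that decides all generators, because there both are
  described by the same model entry. Splitting by one generator after the other
  reduces any element to such elements, so the two sides agree everywhere, in particular
  at the two sides themselves. The hypotheses on \<open>l\<close> and \<open>r\<close> say that these maps identify two
  generators only if the algebra does so on the respective side at every element below both.\<close>

theorem cell_alg_separates:
  assumes X: "finite X" and f: "\<And>x. x \<in> X \<Longrightarrow> f x \<in> elems S"
    and l: "\<And>e x y. \<lbrakk>e \<in> elems S; x \<in> X; y \<in> X; e \<sqinter> f x \<sqinter> e = e; e \<sqinter> f y \<sqinter> e = e; l x = l y\<rbrakk>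
      \<Longrightarrow> f x \<sqinter> e = f y \<sqinter> e"
    and r: "\<And>e x y. \<lbrakk>e \<in> elems S; x \<in> X; y \<in> X; e \<sqinter> f x \<sqinter> e = e; e \<sqinter> f y \<sqinter> e = e; r x = r y\<rbrakk>
      \<Longrightarrow> e \<sqinter> f x = e \<sqinter> f y"
    and s: "set_sk_term s \<subseteq> X" and t: "set_sk_term t \<subseteq> X"
    and st: "sk_eval (cell_alg l r X) (cell_gen l r X) s = sk_eval (cell_alg l r X) (cell_gen l r X) t"
  shows "sk_eval S f s = sk_eval S f t"
proof -
  let ?u = "sk_eval S f s" and ?v = "sk_eval S f t"
  have uv: "?u \<in> elems S" "?v \<in> elems S" using sk_eval_closed[where f=f and X=X, OF f] s t by auto
  have cell: "agree e ?u ?v" if e: "e \<in> elems S" and dec: "\<And>x. x \<in> X \<Longrightarrow> decides e (f x)" for e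
  proof -
    define A where "A = {x \<in> X. e \<sqinter> f x \<sqinter> e = e}"
    have on: "e \<sqinter> f a \<sqinter> e = e" if "a \<in> A" for a using that by (simp add: A_def)
    have off: "e \<sqinter> f x = \<zero> \<and> f x \<sqinter> e = \<zero>" if "x \<in> X - A" for x
      using that dec by (auto simp: A_def decides_def)
    have AX: "A \<subseteq> X" by (auto simp: A_def)
    have cv: "cell_value f l r A e (sk_eval S f w) (sk_eval (cell_alg l r X) (cell_gen l r X) w A)"
      if "set_sk_term w \<subseteq> X" for w
      by (rule cell_value_sk_eval[OF e f AX on off that])
    define c where "c = sk_eval (cell_alg l r X) (cell_gen l r X) t A"
    have val: "cell_value f l r A e ?u c" "cell_value f l r A e ?v c"
      unfolding c_def using cv[OF s] cv[OF t] by (simp_all only: st)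
    show ?thesis
    proof (cases c)
      case None
      thus ?thesis using val by (simp add: cell_value_def agree_def)
    next
      case (Some pq)
      then obtain p q where c: "c = Some (p, q)" by (cases pq) auto
      from val(1) obtain a b where ab: "a \<in> A" "l a = p" "?u \<sqinter> e = f a \<sqinter> e"
        "b \<in> A" "r b = q" "e \<sqinter> ?u = e \<sqinter> f b" by (auto simp: cell_value_def c)
      from val(2) obtain a' b' where ab': "a' \<in> A" "l a' = p" "?v \<sqinter> e = f a' \<sqinter> e"
        "b' \<in> A" "r b' = q" "e \<sqinter> ?v = e \<sqinter> f b'" by (auto simp: cell_value_def c)
      have "f a \<sqinter> e = f a' \<sqinter> e" by (rule l[OF e]) (use ab ab' AX on in auto)
      moreover have "e \<sqinter> f b = e \<sqinter> f b'" by (rule r[OF e]) (use ab ab' AX on in auto)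
      ultimately show ?thesis using ab ab' by (simp add: agree_def)
    qed
  qed
  have all: "agree e ?u ?v"
    if "finite Y" "Y \<subseteq> X" "e \<in> elems S" "\<And>x. x \<in> X - Y \<Longrightarrow> decides e (f x)" for Y e
    using that
  proof (induction Y arbitrary: e)
    case empty
    thus ?case by (intro cell) auto
  next
    case (insert y Y)
    note e = \<open>e \<in> elems S\<close>
    have y: "f y \<in> elems S" using insert f by auto
    show ?case
    proof (rule agree_split[OF e y uv]; rule insert.IH)
      fix x assume x: "x \<in> X - Y"
      show "decides (e \<sqinter> f y \<sqinter> e) (f x)"
        using insert.prems(3)[of x] x f[of x] e y
        by (cases "x = y") (auto intro: decides_meet decides_meet_self)
      show "decides (e \<setminus> f y) (f x)"
        using insert.prems(3)[of x] x f[of x] e y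
        by (cases "x = y") (auto intro: decides_diff decides_diff_self)
    qed (use insert e y in \<open>auto intro: meet_closed diff_closed\<close>)
  qed
  have "agree e ?u ?v" if "e \<in> elems S" for e
    using all[OF X order_refl that] by simp
  thus ?thesis using agree_imp_eq[OF uv] uv by blast
qed

end

section \<open>The free algebra as a product of primitive algebras\<close>

lemma sk_eval_quotient:
  assumes c: "sk_congruence (term_alg X) \<theta>" and t: "set_sk_term t \<subseteq> X"
  shows "sk_eval (sk_quotient (term_alg X) \<theta>) (\<lambda>x. \<theta> `` {Gen x}) t = \<theta> `` {t}"
  using t
proof (induction t)
  case Zero
  show ?case by (simp add: zero_quotient) (simp add: term_alg_def)
next
  case (Meet s t)
  thus ?case using quotient_ops(1)[OF c, of s t] by simp (simp add: term_alg_def)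
next
  case (Join s t)
  thus ?case using quotient_ops(2)[OF c, of s t] by simp (simp add: term_alg_def)
next
  case (Diff s t)
  thus ?case using quotient_ops(3)[OF c, of s t] by simp (simp add: term_alg_def)
qed simp

lemma sk_hom_sk_eval:
  assumes A: "sk_algebra A" and h: "sk_hom h A B" and f: "\<And>x. x \<in> X \<Longrightarrow> f x \<in> elems A"
    and g: "\<And>x. x \<in> X \<Longrightarrow> h (f x) = g x" and t: "set_sk_term t \<subseteq> X"
  shows "h (sk_eval A f t) = sk_eval B g t"
proof -
  have cl: "sk_eval A f t \<in> elems A" if "set_sk_term t \<subseteq> X" for t
    using sk_homD(1)[OF sk_eval_hom[of A X f, OF A f], of t] that by (simp add: term_alg_def)
  show ?thesis using t by (induction t) (simp_all add: cl g sk_homD[OF h])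
qed

text \<open>Surjectivity is generation of the model. For injectivity, elements of the free algebra are
  values of terms at its own generators, so the separation theorem applies to it.\<close>

theorem free_alg_iso_cell_alg:
  fixes V :: "'v sk_term set sk_alg \<Rightarrow> bool" and X :: "'v set"
  defines "F \<equiv> free_alg V X" and "gen \<equiv> free_gen V X"
  assumes X: "finite X" and cong: "sk_congruence (term_alg X) (free_cong V X)"
    and F: "skew_boolean_algebra F"
    and h: "sk_hom h F (cell_alg l r X)" "\<forall>x\<in>X. h (gen x) = cell_gen l r X x"
    and l: "\<And>e x y. \<lbrakk>e \<in> elems F; x \<in> X; y \<in> X;
      e \<sqinter>\<^bsub>F\<^esub> gen x \<sqinter>\<^bsub>F\<^esub> e = e; e \<sqinter>\<^bsub>F\<^esub> gen y \<sqinter>\<^bsub>F\<^esub> e = e; l x = l y\<rbrakk>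
      \<Longrightarrow> gen x \<sqinter>\<^bsub>F\<^esub> e = gen y \<sqinter>\<^bsub>F\<^esub> e"
    and r: "\<And>e x y. \<lbrakk>e \<in> elems F; x \<in> X; y \<in> X;
      e \<sqinter>\<^bsub>F\<^esub> gen x \<sqinter>\<^bsub>F\<^esub> e = e; e \<sqinter>\<^bsub>F\<^esub> gen y \<sqinter>\<^bsub>F\<^esub> e = e; r x = r y\<rbrakk>
      \<Longrightarrow> e \<sqinter>\<^bsub>F\<^esub> gen x = e \<sqinter>\<^bsub>F\<^esub> gen y"
  shows "bij_betw h (elems F) (elems (cell_alg l r X))"
proof -
  let ?M = "cell_alg l r X" and ?g = "cell_gen l r X" and ?T = "{t. set_sk_term t \<subseteq> X}"
  have T: "elems (term_alg X) = ?T" by (simp add: term_alg_def)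
  have A: "sk_algebra F" using F by (simp add: skew_boolean_algebra_def skew_lattice_def)
  have eval_F: "sk_eval F gen t = free_cong V X `` {t}" if "t \<in> ?T" for t
    using sk_eval_quotient[OF cong, of t] that
    by (simp add: F_def gen_def free_alg_def free_gen_def[abs_def])
  have elems_F: "elems F = sk_eval F gen ` ?T"
    using eval_F by (auto simp: F_def free_alg_def elems_quotient quotient_def T)
  have gen: "gen x \<in> elems F" if "x \<in> X" for x
    unfolding elems_F by (rule image_eqI[of _ _ "Gen x"]) (use that in auto)
  have h_eval: "h (sk_eval F gen t) = sk_eval ?M ?g t" if "t \<in> ?T" for t
    by (rule sk_hom_sk_eval[OF A h(1) gen]) (use h(2) that in auto)
  have "inj_on h (elems F)"
  proof (rule inj_onI)
    fix a b assume "a \<in> elems F" "b \<in> elems F" "h a = h b"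
    then obtain s t where st: "s \<in> ?T" "a = sk_eval F gen s" "t \<in> ?T" "b = sk_eval F gen t"
      "sk_eval ?M ?g s = sk_eval ?M ?g t"
      by (auto simp: elems_F h_eval)
    show "a = b" unfolding st(2,4)
      by (rule skew_boolean_algebra.cell_alg_separates[OF F X gen l r _ _ st(5)])
        (use st in auto)
  qed
  moreover have "h ` elems F = elems ?M"
  proof
    show "h ` elems F \<subseteq> elems ?M" using sk_homD(1)[OF h(1)] by blast
    show "elems ?M \<subseteq> h ` elems F"
    proof
      fix m assume "m \<in> elems ?M"
      from cell_alg_generated[OF X this] obtain t where "t \<in> ?T" "m = sk_eval ?M ?g t" by auto
      thus "m \<in> h ` elems F" by (auto simp: elems_F h_eval[symmetric] simp del: cell_alg_simps)
    qed
  qed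
  ultimately show ?thesis by (simp add: bij_betw_def)
qed

lemma card_sk_atoms_iso:
  assumes A: "sk_algebra A" and bij: "bij_betw h (elems A) (elems B)" and h: "sk_hom h A B"
  shows "card (sk_atoms A) = card (sk_atoms B)"
proof -
  interpret A: sk_algebra A by (rule A)
  note inj = inj_on_eq_iff[OF bij_betw_imp_inj_on[OF bij]]
  have surj: "elems B = h ` elems A" using bij by (simp add: bij_betw_def)
  have zero: "h x = \<zero>\<^bsub>B\<^esub> \<longleftrightarrow> x = \<zero>\<^bsub>A\<^esub>" if "x \<in> elems A" for x
    using inj[OF that A.zero_closed] sk_homD(2)[OF h] by simp
  have ge: "sk_ge B (h x) (h y) \<longleftrightarrow> sk_ge A x y" if "x \<in> elems A" "y \<in> elems A" for x y
    using that by (simp add: sk_ge_def sk_homD(3)[OF h, symmetric] inj A.meet_closed)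
  have "h x \<in> sk_atoms B \<longleftrightarrow> x \<in> sk_atoms A" if "x \<in> elems A" for x
    using that by (auto simp: sk_atoms_def surj zero ge inj)
  moreover have "sk_atoms A \<subseteq> elems A" "sk_atoms B \<subseteq> h ` elems A"
    by (auto simp: sk_atoms_def surj)
  ultimately have "h ` sk_atoms A = sk_atoms B" by blast
  moreover have "inj_on h (sk_atoms A)"
    using bij_betw_imp_inj_on[OF bij] \<open>sk_atoms A \<subseteq> elems A\<close> by (rule inj_on_subset)
  ultimately show ?thesis using card_image by metis
qed

section \<open>Counting elements and atoms of the model\<close>

lemma card_cells:
  assumes "finite X" "A \<subseteq> X"
  shows "card (cells l r X A) = card (l ` A) * card (r ` A) + 1"
proof -
  have "cells l r X A = insert None (Some ` (l ` A \<times> r ` A))"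
  proof (rule set_eqI)
    fix c show "c \<in> cells l r X A \<longleftrightarrow> c \<in> insert None (Some ` (l ` A \<times> r ` A))"
      using assms(2) by (cases c) (auto simp: cells_def)
  qed
  moreover have "finite A" using assms finite_subset by blast
  ultimately show ?thesis by (simp add: card_image card_cartesian_product)
qed

text \<open>Restricting to \<open>Pow X\<close> makes the carrier a dependent product of finite sets.\<close>

lemma card_cell_alg:
  assumes X: "finite X"
  shows "card (elems (cell_alg l r X)) = (\<Prod>A\<in>Pow X. card (l ` A) * card (r ` A) + 1)"
proof -
  have "bij_betw (\<lambda>m. restrict m (Pow X)) (elems (cell_alg l r X)) (\<Pi>\<^sub>E A\<in>Pow X. cells l r X A)"
  proof (rule bij_betw_byWitness[where f' = "\<lambda>g A. if A \<subseteq> X then g A else None"])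
    have "None = m A" if "\<forall>A. m A \<in> cells l r X A" "\<not> A \<subseteq> X" for m A
      using that by (cases "m A") (auto simp: cells_def)
    thus "\<forall>m\<in>elems (cell_alg l r X). (\<lambda>A. if A \<subseteq> X then restrict m (Pow X) A else None) = m"
      by (simp add: fun_eq_iff)
    show "\<forall>g\<in>\<Pi>\<^sub>E A\<in>Pow X. cells l r X A. restrict (\<lambda>A. if A \<subseteq> X then g A else None) (Pow X) = g"
      by (auto simp: fun_eq_iff PiE_def extensional_def)
  qed (auto simp: cells_closed split: if_splits)
  hence "card (elems (cell_alg l r X)) = card (\<Pi>\<^sub>E A\<in>Pow X. cells l r X A)"
    by (rule bij_betw_same_card)
  also have "\<dots> = (\<Prod>A\<in>Pow X. card (cells l r X A))" using X by (simp add: card_PiE)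
  also have "\<dots> = (\<Prod>A\<in>Pow X. card (l ` A) * card (r ` A) + 1)"
    using card_cells[OF X] by (intro prod.cong) auto
  finally show ?thesis .
qed

text \<open>The natural order of a primitive algebra is flat, so the atoms of a product of primitive
  algebras are the elements with exactly one nonzero entry.\<close>

lemma card_sk_atoms_cell_alg:
  assumes X: "finite X"
  shows "card (sk_atoms (cell_alg l r X)) = (\<Sum>A\<in>Pow X. card (l ` A) * card (r ` A))"
proof -
  let ?M = "cell_alg l r X"
  define I where "I = Sigma (Pow X) (\<lambda>A. l ` A \<times> r ` A)"
  define single :: "'a set \<times> 'b \<times> 'c \<Rightarrow> 'a set \<Rightarrow> ('b \<times> 'c) option"
    where "single i = (\<lambda>C. if C = fst i then Some (snd i) else None)" for i
  have single_M: "single i \<in> elems ?M" "single i \<noteq> \<zero>\<^bsub>?M\<^esub>" if "i \<in> I" for i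
    using that by (auto simp: single_def I_def cells_def fun_eq_iff)
  have "single ` I = sk_atoms ?M"
  proof (intro equalityI subsetI)
    fix m assume m: "m \<in> sk_atoms ?M"
    hence mM: "m \<in> elems ?M" and "m \<noteq> (\<lambda>A. None)" by (simp_all add: sk_atoms_def)
    then obtain A p q where A: "m A = Some (p, q)" by (auto simp: fun_eq_iff)
    have "m A \<in> cells l r X A" using mM by simp
    hence i: "(A, p, q) \<in> I" using A by (auto simp: I_def cells_def)
    have "sk_ge ?M m (single (A, p, q))" using A by (auto simp: sk_ge_def single_def fun_eq_iff)
    hence "single (A, p, q) = m"
      using m single_M[OF i] unfolding sk_atoms_def by blast
    thus "m \<in> single ` I" using i by blast
  next
    fix m assume "m \<in> single ` I"
    then obtain A p q where i: "(A, p, q) \<in> I" and m: "m = single (A, p, q)" by auto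
    have "b = m" if b: "b \<noteq> \<zero>\<^bsub>?M\<^esub>" and ge: "sk_ge ?M m b" for b
    proof -
      have eqs: "cell_meet (m C) (b C) = b C" "cell_meet (b C) (m C) = b C" for C
        using ge by (auto simp: sk_ge_def fun_eq_iff)
      have off: "b C = None" if "C \<noteq> A" for C
        using eqs(1)[of C] that by (simp add: m single_def)
      have "b A \<noteq> None"
      proof
        assume "b A = None"
        with off have "b C = None" for C by (cases "C = A") auto
        with b show False by (simp add: fun_eq_iff)
      qed
      then obtain c d where "b A = Some (c, d)" by auto
      hence "b A = Some (p, q)" using eqs[of A] by (simp add: m single_def)
      with off show "b = m" by (auto simp: m single_def fun_eq_iff)
    qed
    thus "m \<in> sk_atoms ?M" using single_M[OF i] by (auto simp: sk_atoms_def m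
        simp del: cell_alg_simps)
  qed
  moreover have "inj_on single I"
    by (auto simp: inj_on_def single_def fun_eq_iff split: if_splits)
  ultimately have "card (sk_atoms ?M) = card I" by (metis card_image)
  also have "\<dots> = (\<Sum>A\<in>Pow X. card (l ` A) * card (r ` A))"
    unfolding I_def using X
    by (subst card_SigmaI) (auto simp: card_cartesian_product dest: finite_subset)
  finally show ?thesis .
qed

lemma prod_Pow_card:
  assumes "finite X"
  shows "(\<Prod>A\<in>Pow X. g (card A)) = (\<Prod>k\<le>card X. g k ^ (card X choose k) :: 'c :: comm_monoid_mult)"
proof -
  have "(\<Prod>A\<in>Pow X. g (card A)) = (\<Prod>k\<le>card X. \<Prod>A\<in>{A \<in> Pow X. card A = k}. g (card A))"
    using assms by (intro prod.group[symmetric]) (auto intro: card_mono)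
  also have "\<dots> = (\<Prod>k\<le>card X. g k ^ (card X choose k))"
    using n_subsets[OF assms] by (intro prod.cong) simp_all
  finally show ?thesis .
qed

lemma sum_Pow_card:
  fixes g :: "nat \<Rightarrow> nat"
  assumes "finite X"
  shows "(\<Sum>A\<in>Pow X. g (card A)) = (\<Sum>k\<le>card X. (card X choose k) * g k)"
proof -
  have "(\<Sum>A\<in>Pow X. g (card A)) = (\<Sum>k\<le>card X. \<Sum>A\<in>{A \<in> Pow X. card A = k}. g (card A))"
    using assms by (intro sum.group[symmetric]) (auto intro: card_mono)
  also have "\<dots> = (\<Sum>k\<le>card X. (card X choose k) * g k)"
    using n_subsets[OF assms] by (intro sum.cong) simp_all
  finally show ?thesis .
qed

text \<open>The image of \<open>A\<close> under a constant map is empty if \<open>A\<close> is, so the case \<open>A = {}\<close> is no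
  exception.\<close>

lemma card_times_card_constant_image:
  assumes f: "\<And>x y. f x = f y"
  shows "card A * card (f ` A) = card A" "card (f ` A) * card A = card A"
proof -
  show "card A * card (f ` A) = card A"
  proof (cases "A = {}")
    case False
    then obtain a where "a \<in> A" by blast
    hence "f ` A = {f a}" using f by blast
    thus ?thesis by simp
  qed simp
  thus "card (f ` A) * card A = card A" by (simp only: mult.commute)
qed

lemma atMost_0_insert: "{..n :: nat} = insert 0 {1..n}" by auto

section \<open>The three free algebras\<close>

text \<open>In a left-handed algebra the second coordinate carries no information:
  \<open>e \<sqinter> x \<sqinter> e = e\<close> already gives \<open>e \<sqinter> x = e\<close>, so \<open>r\<close> may be constant.\<close>

lemma LSBA_cards:
  "card (elems (LSBA n)) = card (elems (cell_alg id (\<lambda>_. 0 :: nat) {..<n}))"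
  "card (sk_atoms (LSBA n)) = card (sk_atoms (cell_alg id (\<lambda>_. 0 :: nat) {..<n}))"
proof -
  let ?X = "{..<n}" and ?F = "LSBA n" and ?gen = "free_gen left_handed_sba {..<n}"
  let ?M = "cell_alg id (\<lambda>_. 0 :: nat) ?X"
  interpret F: left_handed_sba ?F unfolding LSBA_def by (rule free_left_handed_sba)
  have M: "left_handed_sba ?M" by (rule cell_alg_left_handed[OF refl])
  obtain h where h: "sk_hom h ?F ?M" "\<forall>x\<in>?X. h (?gen x) = cell_gen id (\<lambda>_. 0 :: nat) ?X x"
    using free_left_handed_sba_universal[where f = "cell_gen id (\<lambda>_. 0 :: nat) ?X" and X = ?X,
        OF M cell_gen_closed]
    unfolding LSBA_def by blast
  have cong: "sk_congruence (term_alg ?X) (free_cong left_handed_sba ?X)"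
    by (rule free_cong_congruence) (rule left_handed_separated)
  have gen: "?gen x \<in> elems ?F" if "x < n" for x
    using that
    by (auto simp: LSBA_def free_gen_def free_alg_def elems_quotient term_alg_def intro!: quotientI)
  have bij: "bij_betw h (elems ?F) (elems ?M)"
    by (rule free_alg_iso_cell_alg[OF _ cong, folded LSBA_def, OF _ F.skew_boolean_algebra_axioms h])
      (auto simp: gen F.left_handed_meet)
  show "card (elems ?F) = card (elems ?M)" by (rule bij_betw_same_card[OF bij])
  show "card (sk_atoms ?F) = card (sk_atoms ?M)"
    by (rule card_sk_atoms_iso[OF F.sk_algebra_axioms bij h(1)])
qed

text \<open>Dually, \<open>x \<sqinter> e = e\<close> whenever \<open>e \<sqinter> x \<sqinter> e = e\<close> in a right-handed algebra.\<close>

lemma RSBA_card_atoms: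
  "card (sk_atoms (RSBA n)) = card (sk_atoms (cell_alg (\<lambda>_. 0 :: nat) id {..<n}))"
proof -
  let ?X = "{..<n}" and ?F = "RSBA n" and ?gen = "free_gen right_handed_sba {..<n}"
  let ?M = "cell_alg (\<lambda>_. 0 :: nat) id ?X"
  interpret F: right_handed_sba ?F unfolding RSBA_def by (rule free_right_handed_sba)
  have M: "right_handed_sba ?M" by (rule cell_alg_right_handed[OF refl])
  obtain h where h: "sk_hom h ?F ?M" "\<forall>x\<in>?X. h (?gen x) = cell_gen (\<lambda>_. 0 :: nat) id ?X x"
    using free_right_handed_sba_universal[where f = "cell_gen (\<lambda>_. 0 :: nat) id ?X" and X = ?X,
        OF M cell_gen_closed]
    unfolding RSBA_def by blast
  have cong: "sk_congruence (term_alg ?X) (free_cong right_handed_sba ?X)"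
    by (rule free_cong_congruence) (rule right_handed_separated)
  have gen: "?gen x \<in> elems ?F" if "x < n" for x
    using that
    by (auto simp: RSBA_def free_gen_def free_alg_def elems_quotient term_alg_def intro!: quotientI)
  have bij: "bij_betw h (elems ?F) (elems ?M)"
    by (rule free_alg_iso_cell_alg[OF _ cong, folded RSBA_def, OF _ F.skew_boolean_algebra_axioms h])
      (auto simp: gen F.right_handed_meet)
  show "card (sk_atoms ?F) = card (sk_atoms ?M)"
    by (rule card_sk_atoms_iso[OF F.sk_algebra_axioms bij h(1)])
qed

lemma SBA_cards:
  "card (elems (SBA n)) = card (elems (cell_alg id id {..<n}))"
  "card (sk_atoms (SBA n)) = card (sk_atoms (cell_alg id id {..<n}))"
proof -
  let ?X = "{..<n}" and ?F = "SBA n" and ?gen = "free_gen skew_boolean_algebra {..<n}"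
  let ?M = "cell_alg id id ?X"
  interpret F: skew_boolean_algebra ?F unfolding SBA_def by (rule free_sba)
  have M: "skew_boolean_algebra ?M" by (rule cell_alg_sba)
  obtain h where h: "sk_hom h ?F ?M" "\<forall>x\<in>?X. h (?gen x) = cell_gen id id ?X x"
    using free_sba_universal[where f = "cell_gen id id ?X" and X = ?X,
        OF M cell_gen_closed]
    unfolding SBA_def by blast
  have cong: "sk_congruence (term_alg ?X) (free_cong skew_boolean_algebra ?X)"
    by (rule free_cong_congruence) (rule sba_separated)
  have gen: "?gen x \<in> elems ?F" if "x < n" for x
    using that
    by (auto simp: SBA_def free_gen_def free_alg_def elems_quotient term_alg_def intro!: quotientI)
  have bij: "bij_betw h (elems ?F) (elems ?M)"
    by (rule free_alg_iso_cell_alg[OF _ cong, folded SBA_def, OF _ F.skew_boolean_algebra_axioms h])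
      (auto simp: gen)
  show "card (elems ?F) = card (elems ?M)" by (rule bij_betw_same_card[OF bij])
  show "card (sk_atoms ?F) = card (sk_atoms ?M)"
    by (rule card_sk_atoms_iso[OF F.sk_algebra_axioms bij h(1)])
qed

theorem corollary4p4:
  fixes n :: nat
  assumes "n \<ge> 1"
  shows "card (elems (LSBA n)) = (\<Prod>k=1..n. (k + 1) ^ (n choose k))
    \<and> card (elems (SBA n)) = (\<Prod>k=1..n. (k\<^sup>2 + 1) ^ (n choose k))
    \<and> card (sk_atoms (LSBA n)) = (\<Sum>k=1..n. (n choose k) * k)
    \<and> card (sk_atoms (RSBA n)) = (\<Sum>k=1..n. (n choose k) * k)
    \<and> card (sk_atoms (SBA n)) = (\<Sum>k=1..n. (n choose k) * k\<^sup>2)"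
proof -
  let ?X = "{..<n}"
  note const = card_times_card_constant_image[where f = "\<lambda>_. 0 :: nat", OF refl]
  have "card (elems (LSBA n)) = (\<Prod>A\<in>Pow ?X. card A + 1)"
    unfolding LSBA_cards by (subst card_cell_alg) (auto simp: const intro!: prod.cong)
  also have "\<dots> = (\<Prod>k=1..n. (k + 1) ^ (n choose k))"
    using prod_Pow_card[of ?X "\<lambda>k. k + 1"] by (simp add: atMost_0_insert)
  finally have i: "card (elems (LSBA n)) = (\<Prod>k=1..n. (k + 1) ^ (n choose k))" .
  have "card (elems (SBA n)) = (\<Prod>A\<in>Pow ?X. (card A)\<^sup>2 + 1)"
    unfolding SBA_cards by (subst card_cell_alg) (simp_all add: power2_eq_square)
  also have "\<dots> = (\<Prod>k=1..n. (k\<^sup>2 + 1) ^ (n choose k))"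
    using prod_Pow_card[of ?X "\<lambda>k. k\<^sup>2 + 1"] by (simp add: atMost_0_insert)
  finally have ii: "card (elems (SBA n)) = (\<Prod>k=1..n. (k\<^sup>2 + 1) ^ (n choose k))" .
  have lin: "(\<Sum>A\<in>Pow ?X. card A) = (\<Sum>k=1..n. (n choose k) * k)"
    using sum_Pow_card[of ?X "\<lambda>k. k"] by (simp add: atMost_0_insert)
  have "card (sk_atoms (LSBA n)) = (\<Sum>A\<in>Pow ?X. card A)"
    unfolding LSBA_cards by (subst card_sk_atoms_cell_alg) (auto simp: const intro!: sum.cong)
  hence iii: "card (sk_atoms (LSBA n)) = (\<Sum>k=1..n. (n choose k) * k)"
    by (simp only: lin)
  have "card (sk_atoms (RSBA n)) = (\<Sum>A\<in>Pow ?X. card A)"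
    unfolding RSBA_card_atoms by (subst card_sk_atoms_cell_alg) (auto simp: const intro!: sum.cong)
  hence iii': "card (sk_atoms (RSBA n)) = (\<Sum>k=1..n. (n choose k) * k)"
    by (simp only: lin)
  have "card (sk_atoms (SBA n)) = (\<Sum>A\<in>Pow ?X. (card A)\<^sup>2)"
    unfolding SBA_cards by (subst card_sk_atoms_cell_alg) (simp_all add: power2_eq_square)
  also have "\<dots> = (\<Sum>k=1..n. (n choose k) * k\<^sup>2)"
    using sum_Pow_card[of ?X "\<lambda>k. k\<^sup>2"] by (simp add: atMost_0_insert)
  finally have iv: "card (sk_atoms (SBA n)) = (\<Sum>k=1..n. (n choose k) * k\<^sup>2)" .
  show ?thesis using i ii iii iii' iv by blast
qed

end
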